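(* Let $n>k>0$ and let $\Gamma$ be a (not necessarily regular) subdivision of $\Delta_{k-1}\times\Delta_{n-k-1}$. Then there exists a subdivision $\Sigma$ of $\Delta(k,n)$ such that: (1) $\Sigma\cap e_{[k]}^\perp=\iota(\Gamma)$; (2) each maximal cell of $\Sigma$ contains the vertex $e_{[k]}$; (3) the tight-spans $T(\Gamma)$ and $T(\Sigma)$ are isomorphic. Furthermore, if $\Gamma$ is induced by a lifting function $V\in\mathbb{R}^{k\times(n-k)}$ and thus regular, then $\Sigma$ is also regular and induced by $\tau_V$. If, however, $\Gamma$ is not regular, then $\Sigma$ is not regular either.
   Context: The hypersimplex is $\Delta(k,n)=\operatorname{conv}\{e_\sigma=\sum_{i\in\sigma}e_i : \sigma\in\binom{[n]}{k}\}\subseteq\mathbb{R}^n$. Let $e_{[k]}^\perp=\{x\in\mathbb{R}^n:\sum_{i=1}^n x_i=k,\ \sum_{i\in[k]}x_i=k-1\}$; $\Delta(k,n)\cap e_{[k]}^\perp$ is the vertex figure of $e_{[k]}$, with vertices the neighbors $e_{([k]\setminus\{i\})\cup\{j\}}$ ($i\in[k]$, $j\in[n]\setminus[k]$). The product $\Delta_{k-1}\times\Delta_{n-k-1}$ is realized with vertices $e_i+e_j$, $i\in[k]$, $j\in[n]\setminus[k]$, and $\iota$ is the bijection $e_i+e_j\mapsto e_{([k]\setminus\{i\})\cup\{j\}}$ onto the vertices of the vertex figure (an affine isomorphism), also applied to subdivisions. For a subdivision $\Sigma$ of $\Delta(k,n)$, $\Sigma\cap e_{[k]}^\perp$ is the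 complex of intersections of the cells of $\Sigma$ with $e_{[k]}^\perp$. A lifting function $V=(v_{ij})\in\mathbb{R}^{k\times(n-k)}$ assigns height $v_{i,j-k}$ to the vertex $e_i+e_j$; regular subdivisions are those induced by projecting the lower faces of the lifted polytope. Tropical determinant $\operatorname{tdet}(A)=\min_{\omega\in\mathrm{Sym}(k)}\sum_i a_{i,\omega(i)}$; $E_k$ is the $k\times k$ matrix with $0$ on the diagonal and $\infty$ elsewhere; $\bar V=(E_k\mid V)$; $\tau_V(\sigma)=\operatorname{tdet}(\bar V_\sigma)$ where $\bar V_\sigma$ consists of the columns of $\bar V$ indexed by $\sigma$, and $\tau_V$ is read as the height function $e_\sigma\mapsto\tau_V(\sigma)$ on $\Delta(k,n)$. The tight-span $T(\cdot)$ of a subdivision of a polytope is the poset of its interior cells (cells not contained in the boundary of the polytope) ordered by reverse inclusion. *)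

theory Defs
  imports "HOL-Analysis.Analysis"
begin

section \<open>Subdivisions of polytopes\<close>

definition vertices :: "'a::euclidean_space set \<Rightarrow> 'a set" where
  "vertices P = {v. v extreme_point_of P}"

text \<open>
  A subdivision is a face-closed finite polytopal complex covering \<open>P\<close> and using no vertices
  other than those of \<open>P\<close>.  As \<open>{}\<close> counts as a face for \<^const>\<open>face_of\<close>, every subdivision
  contains the empty cell.
\<close>

definition subdivision :: "'a::euclidean_space set \<Rightarrow> 'a set set \<Rightarrow> bool" where
  "subdivision P S \<longleftrightarrow>
     finite S \<and>
     (\<forall>C\<in>S. polytope C \<and> vertices C \<subseteq> vertices P) \<and>
     (\<forall>C\<in>S. \<forall>F. F face_of C \<longrightarrow> F \<in> S) \<and>
     (\<forall>C\<in>S. \<forall>D\<in>S. (C \<inter> D) face_of C \<and> (C \<inter> D) face_of D) \<and>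
     \<Union>S = P"

definition maximal_cells :: "'a set set \<Rightarrow> 'a set set" where
  "maximal_cells S = {C\<in>S. \<forall>D\<in>S. C \<subseteq> D \<longrightarrow> D = C}"

definition lifted_polytope :: "'a::euclidean_space set \<Rightarrow> ('a \<Rightarrow> real) \<Rightarrow> ('a \<times> real) set" where
  "lifted_polytope P h = convex hull ((\<lambda>v. (v, h v)) ` vertices P)"

text \<open>
  Lower faces are those with a supporting hyperplane whose inner normal has positive last
  coordinate, normalised to 1.  Small \<open>b\<close> gives the empty face.
\<close>

definition lower_face_of :: "('a::euclidean_space \<times> real) set \<Rightarrow> ('a \<times> real) set \<Rightarrow> bool" where
  "lower_face_of F L \<longleftrightarrow>
     (\<exists>c b. L \<subseteq> {z. (c, 1) \<bullet> z \<ge> b} \<and> F = L \<inter> {z. (c, 1) \<bullet> z = b})"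

definition induced_subdivision :: "'a::euclidean_space set \<Rightarrow> ('a \<Rightarrow> real) \<Rightarrow> 'a set set" where
  "induced_subdivision P h = {fst ` F | F. lower_face_of F (lifted_polytope P h)}"

definition regular_subdivision :: "'a::euclidean_space set \<Rightarrow> 'a set set \<Rightarrow> bool" where
  "regular_subdivision P S \<longleftrightarrow> subdivision P S \<and> (\<exists>h. S = induced_subdivision P h)"

text \<open>
  The tight-span as a (reflexive) order relation, whose field is the set of interior cells:
  \<open>(C, D)\<close> means that \<open>C\<close> is below \<open>D\<close>.  The boundary of a polytope is its relative boundary.
\<close>

definition interior_cells :: "'a::euclidean_space set \<Rightarrow> 'a set set \<Rightarrow> 'a set set" where
  "interior_cells P S = {C\<in>S. \<not> C \<subseteq> rel_frontier P}"

definition tight_span :: "'a::euclidean_space set \<Rightarrow> 'a set set \<Rightarrow> 'a set rel" where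
  "tight_span P S = {(C, D). C \<in> interior_cells P S \<and> D \<in> interior_cells P S \<and> D \<subseteq> C}"

definition poset_isomorphic :: "'a rel \<Rightarrow> 'b rel \<Rightarrow> bool" where
  "poset_isomorphic r s \<longleftrightarrow>
     (\<exists>f. bij_betw f (Field r) (Field s) \<and>
          (\<forall>x\<in>Field r. \<forall>y\<in>Field r. (x, y) \<in> r \<longleftrightarrow> (f x, f y) \<in> s))"

lemma Field_tight_span: "Field (tight_span P S) = interior_cells P S"
  by (auto simp: tight_span_def Field_def)

section \<open>Hypersimplices and products of simplices\<close>

text \<open>
  The index set \<open>[n]\<close> is a type \<open>'k + 'm\<close> with \<open>CARD('k) = k\<close> and \<open>CARD('m) = n - k\<close>; the left
  summand is \<open>[k]\<close> and the right one is \<open>[n] - [k]\<close>.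
\<close>

definition e_vec :: "'n::finite set \<Rightarrow> real^'n" where
  "e_vec \<sigma> = (\<Sum>i\<in>\<sigma>. axis i 1)"

definition hypersimplex :: "nat \<Rightarrow> (real^'n::finite) set" where
  "hypersimplex k = convex hull (e_vec ` {\<sigma>. card \<sigma> = k})"

abbreviation initial_block :: "('k + 'm) set" where
  "initial_block \<equiv> range Inl"

definition perp_initial_block :: "(real^('k::finite + 'm::finite)) set" where
  "perp_initial_block =
     {x. (\<Sum>l\<in>UNIV. x $ l) = real CARD('k) \<and> (\<Sum>l\<in>initial_block. x $ l) = real CARD('k) - 1}"

definition prod_vertex :: "'k::finite \<Rightarrow> 'm::finite \<Rightarrow> real^('k + 'm)" where
  "prod_vertex i j = axis (Inl i) 1 + axis (Inr j) 1"

definition simplex_product :: "(real^('k::finite + 'm::finite)) set" where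
  "simplex_product = convex hull {prod_vertex i j | i j. True}"

text \<open>
  The affine map extending the bijection of vertices stated in \<open>iota_prod_vertex\<close> below.
\<close>

definition iota :: "real^('k::finite + 'm::finite) \<Rightarrow> real^('k + 'm)" where
  "iota x = (\<chi> l. case l of Inl i \<Rightarrow> 1 - x $ Inl i | Inr j \<Rightarrow> x $ Inr j)"

lemma e_vec_nth: "e_vec \<sigma> $ l = (if l \<in> \<sigma> then 1 else 0)"
  by (simp add: e_vec_def axis_def sum.delta)

lemma iota_prod_vertex:
  "iota (prod_vertex i j) = e_vec ((initial_block - {Inl i}) \<union> {Inr j})"
  by (auto simp: vec_eq_iff iota_def prod_vertex_def e_vec_nth axis_def split: sum.splits)

section \<open>Heights\<close>

text \<open>A lifting matrix as a height function: \<open>prod_vertex i j\<close> gets height \<open>V $ i $ j\<close>.\<close>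

definition lifting_height :: "real^'m^'k \<Rightarrow> real^('k::finite + 'm::finite) \<Rightarrow> real" where
  "lifting_height V x = V $ (THE i. x $ Inl i = 1) $ (THE j. x $ Inr j = 1)"

lemma lifting_height_prod_vertex: "lifting_height V (prod_vertex i j) = V $ i $ j"
proof -
  have "(THE i'. prod_vertex i j $ Inl i' = 1) = i" "(THE j'. prod_vertex i j $ Inr j' = 1) = j"
    by (auto simp: prod_vertex_def axis_def)
  then show ?thesis by (simp add: lifting_height_def)
qed

text \<open>
  The tropical determinant of the square submatrix of \<open>A\<close> given by the columns in \<open>\<sigma>\<close>.  It does
  not depend on the order of these columns, so permutations are replaced by bijections from the
  rows to \<open>\<sigma>\<close>.
\<close>

definition tdet :: "ereal^'n^'k \<Rightarrow> 'n::finite set \<Rightarrow> ereal" where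
  "tdet A \<sigma> = Min {\<Sum>i\<in>UNIV. A $ i $ \<omega> i | \<omega>. bij_betw \<omega> (UNIV :: 'k::finite set) \<sigma>}"

definition tropical_id :: "ereal^'k^'k::finite" where
  "tropical_id = (\<chi> i j. if i = j then 0 else \<infinity>)"

definition V_bar :: "real^'m^'k \<Rightarrow> ereal^('k::finite + 'm::finite)^'k" where
  "V_bar V = (\<chi> i l. case l of Inl j \<Rightarrow> tropical_id $ i $ j | Inr j \<Rightarrow> ereal (V $ i $ j))"

definition tau :: "real^'m^'k \<Rightarrow> ('k::finite + 'm::finite) set \<Rightarrow> ereal" where
  "tau V \<sigma> = tdet (V_bar V) \<sigma>"

text \<open>
  The height of \<open>e_vec \<sigma>\<close> is \<open>tau V \<sigma>\<close>, which is finite for \<open>card \<sigma> = CARD('k)\<close>.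
\<close>

definition tau_height :: "real^'m^'k \<Rightarrow> real^('k::finite + 'm::finite) \<Rightarrow> real" where
  "tau_height V x = real_of_ereal (tau V {l. x $ l = 1})"

lemma ereal_sum_not_MInf:
  fixes f :: "'a \<Rightarrow> ereal"
  assumes "\<And>i. f i \<noteq> -\<infinity>"
  shows "sum f A \<noteq> -\<infinity>"
  using assms by (induction A rule: infinite_finite_induct) auto

lemma tau_finite:
  fixes V :: "real^'m::finite^'k::finite"
  assumes "card \<sigma> = CARD('k)"
  shows "\<bar>tau V \<sigma>\<bar> \<noteq> \<infinity>"
proof -
  let ?S = "{\<Sum>i\<in>UNIV. V_bar V $ i $ \<omega> i | \<omega>. bij_betw \<omega> (UNIV :: 'k set) \<sigma>}"
  let ?A = "{i. Inl i \<in> \<sigma>}" and ?B = "{j. Inr j \<in> \<sigma>}"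
  have fin: "finite ?S" by simp
  have \<sigma>: "\<sigma> = Inl ` ?A \<union> Inr ` ?B"
    by (auto simp: image_iff) (metis sum.exhaust)
  have "card \<sigma> = card ?A + card ?B"
    by (subst \<sigma>, subst card_Un_disjoint) (auto simp: card_image)
  then have "card (- ?A) = card ?B"
    using assms by (simp add: Compl_eq_Diff_UNIV card_Diff_subset)
  then obtain g where g: "bij_betw g (- ?A) ?B"
    by (meson finite finite_same_card_bij)
  define \<omega> where "\<omega> i = (if i \<in> ?A then Inl i else Inr (g i))" for i
  have "bij_betw \<omega> (?A \<union> - ?A) (Inl ` ?A \<union> Inr ` ?B)"
  proof (rule bij_betw_combine)
    show "bij_betw \<omega> ?A (Inl ` ?A)"
      by (auto simp: bij_betw_def inj_on_def \<omega>_def)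
    show "bij_betw \<omega> (- ?A) (Inr ` ?B)"
      using g by (auto simp: bij_betw_def inj_on_def \<omega>_def image_iff)
  qed auto
  then have bij: "bij_betw \<omega> UNIV \<sigma>" using \<sigma> by simp
  have le: "tau V \<sigma> \<le> (\<Sum>i\<in>UNIV. V_bar V $ i $ \<omega> i)"
    unfolding tau_def tdet_def using bij fin by (intro Min_le) auto
  have "(\<Sum>i\<in>UNIV. V_bar V $ i $ \<omega> i) \<noteq> \<infinity>"
    by (auto simp: sum_Pinfty \<omega>_def V_bar_def tropical_id_def)
  with le have 1: "tau V \<sigma> \<noteq> \<infinity>" by auto
  have "tau V \<sigma> \<in> ?S"
    unfolding tau_def tdet_def using bij fin by (intro Min_in) auto
  then obtain \<rho> where "tau V \<sigma> = (\<Sum>i\<in>UNIV. V_bar V $ i $ \<rho> i)" by auto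
  moreover have "V_bar V $ i $ l \<noteq> -\<infinity>" for i l
    by (auto simp: V_bar_def tropical_id_def split: sum.splits)
  ultimately have 2: "tau V \<sigma> \<noteq> -\<infinity>"
    by (simp add: ereal_sum_not_MInf)
  from 1 2 show ?thesis by auto
qed

lemma tau_height_e_vec:
  fixes V :: "real^'m::finite^'k::finite"
  assumes "card \<sigma> = CARD('k)"
  shows "ereal (tau_height V (e_vec \<sigma>)) = tau V \<sigma>"
  using tau_finite[OF assms, of V] by (simp add: tau_height_def e_vec_nth ereal_real)

end

theory Submission
  imports Defs
begin

text \<open>
  In the coordinates given by \<open>iota\<close> the vertex \<open>e_vec initial_block\<close> becomes the origin, the
  hypersimplex becomes the intersection of the cone over the product of simplices with the unit
  cube, and the vertex figure becomes the product of simplices itself.  The cells of \<open>\<Sigma>\<close> are the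
  faces of the truncated cones over the cells of \<open>\<Gamma>\<close>.  They have no new vertices because the
  bipartite matching polytope is integral: the truncated cone over the convex hull of a set \<open>E\<close> of
  vertices \<open>prod_vertex i j\<close> is the convex hull of the sums over the matchings in \<open>E\<close>.  A face of a
  truncated cone that meets the relative interior of the hypersimplex contains the apex, so it is
  the truncated cone over its own slice; this identifies the interior cells.  The tropical
  determinant is the minimal weight of a matching, so a functional supporting the lift of a cell
  supports, after normalisation, the lift of the truncated cone.  For equality of subdivisions
  one inclusion suffices, since the relative interiors of the cells already cover the polytope.
\<close>

section \<open>Subdivisions and lower faces\<close>

text \<open>If \<open>\<Gamma>\<close> is not regular, there is no height function to extend, so
  \<open>\<Sigma>\<close> has to be built geometrically. The cone over
  \<open>simplex_product\<close> is the tangent cone of the hypersimplex at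
  \<open>e_vec initial_block\<close>, and it is subdivided by the cones over the cells; what the
  hypersimplex adds are the bounds \<open>x $ l \<le> 1\<close>. The obstacle is that such bounds
  can create fractional vertices: in a general graph, a triangle with weights 1/2 is one. This is
  where bipartiteness enters. Most of the remaining geometry is radial: nonzero points are compared
  through their multiples with \<open>left_sum\<close> equal to 1. Regularity passes from
  \<open>\<Sigma>\<close> to \<open>\<Gamma>\<close> by restricting a height function to the slice,
  whose vertices are vertices of the whole polytope.\<close>

lemma vertices_convex_hull_subset: "vertices (convex hull S) \<subseteq> S"
  by (auto simp: vertices_def dest: extreme_point_of_convex_hull)

lemma convex_hull_vertices:
  assumes "polytope P"
  shows "convex hull vertices P = P"
  unfolding vertices_def
  using Krein_Milman_Minkowski[of P] assms polytope_imp_compact polytope_imp_convex by metis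

lemma finite_vertices: "polytope P \<Longrightarrow> finite (vertices P)"
  unfolding vertices_def using finite_polyhedron_extreme_points polytope_imp_polyhedron by blast

lemma vertices_subset: "vertices P \<subseteq> P"
  by (auto simp: vertices_def extreme_point_of_def)

lemma vertices_face_subset:
  assumes "F face_of P"
  shows "vertices F \<subseteq> vertices P"
  using assms unfolding vertices_def by (auto simp: extreme_point_of_face)

lemma polytope_lifted_polytope: "polytope P \<Longrightarrow> polytope (lifted_polytope P h)"
  unfolding lifted_polytope_def using finite_vertices by (intro polytope_convex_hull finite_imageI)

lemma fst_lifted_polytope:
  assumes "polytope P"
  shows "fst ` lifted_polytope P h = P"
  unfolding lifted_polytope_def convex_hull_linear_image[OF linear_fst]
  by (simp add: image_image convex_hull_vertices assms)

lemma lower_face_imp_face: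
  assumes "lower_face_of F (lifted_polytope P h)"
  shows "F face_of lifted_polytope P h"
  using assms unfolding lower_face_of_def
  by (auto simp: lifted_polytope_def intro!: face_of_Int_supporting_hyperplane_ge)

text \<open>The fibre of the lift over an extreme point is a face, hence the hull of those
  generators that lie over \<open>v\<close>, and there is just one.\<close>

lemma lifted_polytope_over_vertex:
  assumes "polytope P" "v \<in> vertices P" "(v, s) \<in> lifted_polytope P h"
  shows "s = h v"
proof -
  let ?X = "(\<lambda>v. (v, h v)) ` vertices P"
  let ?T = "lifted_polytope P h \<inter> fst -` {v}"
  have v: "v extreme_point_of P" using assms(2) by (simp add: vertices_def)
  have "?T face_of lifted_polytope P h"
    unfolding face_of_def
  proof (intro conjI ballI impI)
    show "convex ?T"
      by (intro convex_Int convex_linear_vimage) (auto simp: lifted_polytope_def linear_fst)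
    fix a b x
    assume ab: "a \<in> lifted_polytope P h" "b \<in> lifted_polytope P h" and "x \<in> ?T"
      and x: "x \<in> open_segment a b"
    have ab': "fst a \<in> P" "fst b \<in> P" using ab fst_lifted_polytope[OF assms(1), of h] by blast+
    have fx: "fst x = v" using \<open>x \<in> ?T\<close> by auto
    obtain u where u: "0 < u" "u < 1" "x = (1 - u) *\<^sub>R a + u *\<^sub>R b"
      using x by (auto simp: in_segment)
    then have "v = (1 - u) *\<^sub>R fst a + u *\<^sub>R fst b" using fx by auto
    moreover have "v \<notin> open_segment (fst a) (fst b)"
      using v ab' by (auto simp: extreme_point_of_def)
    ultimately have eq: "fst a = fst b" using u by (auto simp: in_segment)
    then have "v = fst a" using \<open>v = _\<close> by (simp add: algebra_simps)
    then show "a \<in> ?T" "b \<in> ?T" using ab eq by auto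
  qed auto
  then obtain X' where X': "X' \<subseteq> ?X" "?T = convex hull X'"
    using face_of_convex_hull_subset[of ?X ?T] finite_vertices[OF assms(1)]
    by (auto simp: lifted_polytope_def finite_imp_compact)
  have "X' \<subseteq> {(v, h v)}"
  proof
    fix x assume "x \<in> X'"
    then have "x \<in> ?X" "x \<in> ?T" using X' hull_subset[of X' convex] by blast+
    then show "x \<in> {(v, h v)}" by auto
  qed
  then have "convex hull X' \<subseteq> {(v, h v)}" by (simp add: hull_minimal)
  moreover have "(v, s) \<in> ?T" using assms(3) by simp
  ultimately show ?thesis unfolding X'(2) by auto
qed

text \<open>
  The normal \<open>a\<close> exposing the face may have a negative last coordinate; adding a large multiple of
  the normal of the lower face corrects this without changing the set where both are tight.
\<close>

lemma lower_face_of_face: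
  assumes "polytope L" "lower_face_of F L" "G face_of F"
  shows "lower_face_of G L"
proof -
  obtain c b where cb: "L \<subseteq> {z. (c, 1) \<bullet> z \<ge> b}" "F = L \<inter> {z. (c, 1) \<bullet> z = b}"
    using assms(2) by (auto simp: lower_face_of_def)
  have "F face_of L" using cb assms(1)
    by (auto intro!: face_of_Int_supporting_hyperplane_ge polytope_imp_convex)
  then have "G exposed_face_of L"
    using assms face_of_trans exposed_face_of_polyhedron polytope_imp_polyhedron by blast
  then obtain a \<beta> where a: "L \<subseteq> {x. a \<bullet> x \<le> \<beta>}" "G = L \<inter> {x. a \<bullet> x = \<beta>}"
    by (auto simp: exposed_face_of_def)
  obtain d s where ds: "a = (d, s)" by (cases a)
  \<comment> \<open>\<open>N\<close> exceeds \<open>s\<close>, so \<open>N\<close> times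
    \<open>(c, 1)\<close> minus \<open>a\<close> has the positive last coordinate
    \<open>N - s\<close>, by which it is then divided.\<close>
  define N where "N = \<bar>s\<bar> + 1"
  have N: "N > 0" "N - s > 0" by (auto simp: N_def)
  define c' where "c' = (1 / (N - s)) *\<^sub>R (N *\<^sub>R c - d)"
  define b' where "b' = (N * b - \<beta>) / (N - s)"
  have eq: "(c', 1) \<bullet> z - b' = (N * ((c, 1) \<bullet> z - b) + (\<beta> - a \<bullet> z)) / (N - s)" for z
  proof -
    have "c' \<bullet> fst z * (N - s) = N * (c \<bullet> fst z) - d \<bullet> fst z" "b' * (N - s) = N * b - \<beta>"
      using N(2) by (simp_all add: c'_def b'_def inner_diff_left)
    then have "((c', 1) \<bullet> z - b') * (N - s) = N * ((c, 1) \<bullet> z - b) + (\<beta> - a \<bullet> z)"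
      by (simp add: ds inner_prod_def algebra_simps)
    then show ?thesis using N(2) by (simp add: eq_divide_eq)
  qed
  have nn: "0 \<le> N * ((c, 1) \<bullet> z - b)" "0 \<le> \<beta> - a \<bullet> z" if "z \<in> L" for z
    using that cb a N by auto
  have "L \<subseteq> {z. (c', 1) \<bullet> z \<ge> b'}"
  proof
    fix z assume "z \<in> L"
    then have "0 \<le> (c', 1) \<bullet> z - b'" unfolding eq using nn[of z] N by simp
    then show "z \<in> {z. (c', 1) \<bullet> z \<ge> b'}" by simp
  qed
  moreover have "G = L \<inter> {z. (c', 1) \<bullet> z = b'}"
  proof -
    have "(c', 1) \<bullet> z = b' \<longleftrightarrow> z \<in> G" if "z \<in> L" for z
    proof -
      have "(c', 1) \<bullet> z = b' \<longleftrightarrow> (c', 1) \<bullet> z - b' = 0" by simp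
      also have "\<dots> \<longleftrightarrow> N * ((c, 1) \<bullet> z - b) = 0 \<and> \<beta> - a \<bullet> z = 0"
        unfolding eq using nn[OF that] N by (simp add: add_nonneg_eq_0_iff)
      also have "\<dots> \<longleftrightarrow> z \<in> F \<and> z \<in> G" using N that cb(2) a(2) by auto
      also have "\<dots> \<longleftrightarrow> z \<in> G" using face_of_imp_subset[OF assms(3)] by auto
      finally show ?thesis .
    qed
    moreover have "G \<subseteq> L" using a(2) by auto
    ultimately show ?thesis by auto
  qed
  ultimately show ?thesis by (auto simp: lower_face_of_def)
qed

text \<open>Faces pull back along the projection, so a face of a cell comes from a face of a lower
  face. Thus only the truncated cones, not their faces, have to be matched with lower faces
  later.\<close>

lemma induced_subdivision_face:
  assumes "polytope P" "C \<in> induced_subdivision P h" "G face_of C"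
  shows "G \<in> induced_subdivision P h"
proof -
  obtain F where F: "C = fst ` F" "lower_face_of F (lifted_polytope P h)"
    using assms(2) by (auto simp: induced_subdivision_def)
  have convF: "convex F" using lower_face_imp_face[OF F(2)] face_of_imp_convex by blast
  have GC: "G \<subseteq> C" using assms(3) face_of_imp_subset by blast
  have "(F \<inter> fst -` G) face_of F"
    unfolding face_of_def
  proof (intro conjI ballI impI)
    show "convex (F \<inter> fst -` G)"
      using assms(3) face_of_imp_convex convF
      by (intro convex_Int convex_linear_vimage) (auto simp: linear_fst)
    fix a b x
    assume ab: "a \<in> F" "b \<in> F" and "x \<in> F \<inter> fst -` G" and x: "x \<in> open_segment a b"
    obtain u where u: "0 < u" "u < 1" "x = (1 - u) *\<^sub>R a + u *\<^sub>R b"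
      using x by (auto simp: in_segment)
    have "fst a \<in> C" "fst b \<in> C" using ab F(1) by auto
    moreover have fx: "fst x = (1 - u) *\<^sub>R fst a + u *\<^sub>R fst b" "fst x \<in> G"
      using u \<open>x \<in> F \<inter> fst -` G\<close> by auto
    ultimately have "fst a \<in> G \<and> fst b \<in> G"
    proof (cases "fst a = fst b")
      case True
      then show ?thesis using fx by (simp add: algebra_simps)
    next
      case False
      then have "fst x \<in> open_segment (fst a) (fst b)" using u fx by (auto simp: in_segment)
      then show ?thesis using \<open>fst a \<in> C\<close> \<open>fst b \<in> C\<close> fx assms(3) unfolding face_of_def by blast
    qed
    then show "a \<in> F \<inter> fst -` G" "b \<in> F \<inter> fst -` G" using ab by auto
  qed auto
  then have "lower_face_of (F \<inter> fst -` G) (lifted_polytope P h)"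
    using lower_face_of_face[OF polytope_lifted_polytope[OF assms(1)] F(2)] by blast
  moreover have "G = fst ` (F \<inter> fst -` G)" using GC F(1) by blast
  ultimately show ?thesis by (auto simp: induced_subdivision_def)
qed

text \<open>A minimal cell containing \<open>x\<close> works: were \<open>x\<close> in its relative
  frontier, a proper face, which is again a cell, would contain \<open>x\<close>.\<close>

lemma subdivision_cell_rel_interior:
  assumes "subdivision P S" "x \<in> P"
  obtains C where "C \<in> S" "x \<in> rel_interior C"
proof -
  have fin: "finite {C\<in>S. x \<in> C}" "{C\<in>S. x \<in> C} \<noteq> {}"
    using assms by (auto simp: subdivision_def)
  then obtain C where C: "C \<in> S" "x \<in> C" and min: "\<And>D. D \<in> S \<Longrightarrow> x \<in> D \<Longrightarrow> D \<subseteq> C \<Longrightarrow> D = C"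
    using finite_has_minimal[OF fin] by auto
  have "polytope C" using assms C by (simp add: subdivision_def)
  have "x \<in> rel_interior C"
  proof (rule ccontr)
    assume "x \<notin> rel_interior C"
    then have "x \<in> rel_frontier C" using C closure_subset by (auto simp: rel_frontier_def)
    then obtain F where F: "F face_of C" "F \<noteq> C" "x \<in> F"
      using rel_frontier_of_polyhedron_alt[OF polytope_imp_polyhedron[OF \<open>polytope C\<close>]] by auto
    then have "F \<in> S" using assms C by (auto simp: subdivision_def)
    then show False using min[of F] F face_of_imp_subset by blast
  qed
  then show thesis using that C by blast
qed

text \<open>Over each point of its shadow a lower face contains only the lowest point of the lift. A
  common relative interior point of the shadows therefore lifts to a common one of \<open>F\<close>
  and \<open>G\<close>, and faces whose relative interiors meet coincide.\<close>

lemma lower_faces_eq: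
  assumes "polytope P" "lower_face_of F (lifted_polytope P h)" "lower_face_of G (lifted_polytope P h)"
    and "rel_interior (fst ` F) \<inter> rel_interior (fst ` G) \<noteq> {}"
  shows "F = G"
proof -
  have conv: "convex F" "convex G"
    using assms lower_face_imp_face face_of_imp_convex by blast+
  then obtain z w where zw: "z \<in> rel_interior F" "w \<in> rel_interior G" "fst z = fst w"
    using assms(4) by (auto simp: rel_interior_convex_linear_image[OF linear_fst, symmetric])
  then have "z \<in> F" "w \<in> G" using rel_interior_subset by blast+
  have le: "snd x \<le> snd y"
    if xy: "lower_face_of E (lifted_polytope P h)" "x \<in> E" "y \<in> lifted_polytope P h" "fst x = fst y"
    for E x y
  proof -
    obtain c b where "lifted_polytope P h \<subseteq> {z. (c, 1) \<bullet> z \<ge> b}" "(c, 1) \<bullet> x = b"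
      using xy by (auto simp: lower_face_of_def)
    then have "(c, 1) \<bullet> x \<le> (c, 1) \<bullet> y" using xy by auto
    then show ?thesis using xy by (simp add: inner_prod_def)
  qed
  have "z \<in> lifted_polytope P h" "w \<in> lifted_polytope P h"
    using \<open>z \<in> F\<close> \<open>w \<in> G\<close> assms(2,3) by (auto simp: lower_face_of_def)
  then have "snd z = snd w"
    using le[OF assms(2) \<open>z \<in> F\<close>, of w] le[OF assms(3) \<open>w \<in> G\<close>, of z] zw(3) by simp
  then have "z = w" using zw by (simp add: prod_eq_iff)
  then show ?thesis
    using face_of_eq assms(2,3) lower_face_imp_face zw by blast
qed

lemma subdivision_subset_induced_imp_eq:
  assumes "polytope P" "P \<noteq> {}" "subdivision P S" "S \<subseteq> induced_subdivision P h"
  shows "S = induced_subdivision P h"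
proof
  show "induced_subdivision P h \<subseteq> S"
  proof
    fix D assume "D \<in> induced_subdivision P h"
    then obtain F where F: "D = fst ` F" "lower_face_of F (lifted_polytope P h)"
      by (auto simp: induced_subdivision_def)
    have "convex D"
      using F lower_face_imp_face face_of_imp_convex convex_linear_image[OF linear_fst] by blast
    show "D \<in> S"
    proof (cases "D = {}")
      case True
      \<comment> \<open>The empty cell has no relative interior point, but it is a face of any cell
        of \<open>S\<close>.\<close>
      obtain C where "C \<in> S" using assms(2,3) by (auto simp: subdivision_def)
      then show ?thesis using assms(3) True empty_face_of by (auto simp: subdivision_def)
    next
      case False
      then obtain x where x: "x \<in> rel_interior D"
        using \<open>convex D\<close> rel_interior_eq_empty by blast
      have "F \<subseteq> lifted_polytope P h" using F by (auto simp: lower_face_of_def)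
      then have "D \<subseteq> P" using F fst_lifted_polytope[OF assms(1)] by blast
      then obtain C where C: "C \<in> S" "x \<in> rel_interior C"
        using subdivision_cell_rel_interior[OF assms(3)] x rel_interior_subset by blast
      then obtain G where G: "C = fst ` G" "lower_face_of G (lifted_polytope P h)"
        using assms(4) by (auto simp: induced_subdivision_def)
      have "F = G" using lower_faces_eq[OF assms(1) F(2) G(2)] x C F G by auto
      then show ?thesis using C F G by simp
    qed
  qed
qed (fact assms(4))

text \<open>The functional supporting \<open>C\<close> is reused on the smaller lift of
  \<open>P\<close>. A vertex of \<open>C \<inter> P\<close> is also a vertex of \<open>Q\<close>, so
  its height in the lift of \<open>Q\<close> is forced to be \<open>h v\<close>, and the same point
  occurs in the lift of \<open>P\<close>.\<close>

lemma induced_subdivision_Int: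
  assumes "polytope P" "polytope Q" "vertices P \<subseteq> vertices Q"
    and "C \<in> induced_subdivision Q h"
    and "polytope (C \<inter> P)" "vertices (C \<inter> P) \<subseteq> vertices P"
  shows "C \<inter> P \<in> induced_subdivision P h"
proof -
  obtain c b where cb: "lifted_polytope Q h \<subseteq> {z. (c, 1) \<bullet> z \<ge> b}"
    and C: "C = fst ` (lifted_polytope Q h \<inter> {z. (c, 1) \<bullet> z = b})"
    using assms(4) by (auto simp: induced_subdivision_def lower_face_of_def)
  have sub: "lifted_polytope P h \<subseteq> lifted_polytope Q h"
    unfolding lifted_polytope_def by (intro hull_mono image_mono assms)
  let ?F = "lifted_polytope P h \<inter> {z. (c, 1) \<bullet> z = b}"
  have F: "lower_face_of ?F (lifted_polytope P h)"
    using cb sub by (auto simp: lower_face_of_def)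
  have "convex (fst ` ?F)"
    using lower_face_imp_face[OF F] face_of_imp_convex convex_linear_image[OF linear_fst] by blast
  have "vertices (C \<inter> P) \<subseteq> fst ` ?F"
  proof
    fix v assume v: "v \<in> vertices (C \<inter> P)"
    then have "v \<in> C" using vertices_subset by blast
    then obtain s where s: "(v, s) \<in> lifted_polytope Q h" "(c, 1) \<bullet> (v, s) = b" using C by auto
    have "s = h v" using lifted_polytope_over_vertex[OF assms(2) _ s(1)] v assms by blast
    moreover have "(v, h v) \<in> lifted_polytope P h"
      unfolding lifted_polytope_def using v assms(6) by (intro hull_inc) auto
    ultimately show "v \<in> fst ` ?F" using s by force
  qed
  then have "C \<inter> P \<subseteq> fst ` ?F"
    using hull_minimal[of _ _ convex] \<open>convex (fst ` ?F)\<close> convex_hull_vertices[OF assms(5)] by metis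
  moreover have "fst ` ?F \<subseteq> C \<inter> P"
    using sub C fst_lifted_polytope[OF assms(1), of h] by blast
  ultimately show ?thesis
    using F unfolding induced_subdivision_def by blast
qed

section \<open>Change of coordinates for subdivisions, boundaries and lifts\<close>

section \<open>Transport along affine isometries\<close>

lemma face_of_affine_image:
  assumes "linear A" "inj A"
  shows "(\<lambda>x. a + A x) ` T face_of (\<lambda>x. a + A x) ` S \<longleftrightarrow> T face_of S"
  using face_of_translation_eq[of a "A ` T" "A ` S"] face_of_linear_image[OF assms]
  by (simp add: image_image)

lemma vertices_affine_image:
  assumes "linear A" "inj A"
  shows "vertices ((\<lambda>x. a + A x) ` S) = (\<lambda>x. a + A x) ` vertices S"
proof -
  have "a + A x \<in> vertices ((\<lambda>x. a + A x) ` S) \<longleftrightarrow> x \<in> vertices S" for x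
    using face_of_affine_image[OF assms, of a "{x}" S] by (simp add: vertices_def face_of_singleton)
  then show ?thesis using vertices_subset[of "(\<lambda>x. a + A x) ` S"] by blast
qed

lemma convex_hull_affine_image:
  assumes "linear A"
  shows "convex hull ((\<lambda>x. a + A x) ` S) = (\<lambda>x. a + A x) ` (convex hull S)"
proof -
  have "(\<lambda>x. a + A x) ` T = (+) a ` A ` T" for T by (simp add: image_image)
  then show ?thesis by (simp only: convex_hull_translation convex_hull_linear_image[OF assms])
qed

lemma polytope_affine_image: "linear A \<Longrightarrow> polytope S \<Longrightarrow> polytope ((\<lambda>x. a + A x) ` S)"
  using polytope_translation_eq[of a "A ` S"] polytope_linear_image[of A S] by (simp add: image_image)

lemma rel_frontier_affine_image:
  fixes A :: "'a::euclidean_space \<Rightarrow> 'a"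
  assumes "linear A" "inj A"
  shows "rel_frontier ((\<lambda>x. a + A x) ` S) = (\<lambda>x. a + A x) ` rel_frontier S"
proof -
  have "rel_frontier (A ` S) = A ` rel_frontier S"
    using assms by (simp add: rel_frontier_def rel_interior_injective_linear_image
        linear_conv_bounded_linear[symmetric] closure_injective_linear_image image_set_diff)
  then show ?thesis using rel_frontier_translation[of a "A ` S"] by (simp add: image_image)
qed

lemma subdivision_affine_image:
  fixes A :: "'a::euclidean_space \<Rightarrow> 'a"
  assumes "linear A" "inj A" "subdivision P S"
  shows "subdivision ((\<lambda>x. a + A x) ` P) ((`) (\<lambda>x. a + A x) ` S)"
proof -
  let ?f = "\<lambda>x. a + A x"
  have inj: "inj ?f" using assms(2) by (simp add: inj_def)
  have faces: "F \<in> (`) ?f ` S" if "C \<in> S" "F face_of ?f ` C" for C F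
  proof -
    have "F \<subseteq> ?f ` C" using that face_of_imp_subset by blast
    then obtain G where "F = ?f ` G" by (meson subset_imageE)
    then show ?thesis using that assms face_of_affine_image[OF assms(1,2)]
      by (auto simp: subdivision_def)
  qed
  have Int: "(?f ` C \<inter> ?f ` D) face_of ?f ` C \<and> (?f ` C \<inter> ?f ` D) face_of ?f ` D"
    if "C \<in> S" "D \<in> S" for C D
    using that assms(3) face_of_affine_image[OF assms(1,2)]
    by (simp add: image_Int[OF inj, symmetric] subdivision_def)
  show ?thesis
    unfolding subdivision_def
  proof (intro conjI ballI allI impI)
    show "\<Union> ((`) ?f ` S) = ?f ` P" using assms(3) by (auto simp: subdivision_def)
    show "finite ((`) ?f ` S)" using assms(3) by (simp add: subdivision_def)
    fix C assume C: "C \<in> (`) ?f ` S"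
    then obtain D where "D \<in> S" "C = ?f ` D" by blast
    moreover from this have "polytope D" "vertices D \<subseteq> vertices P"
      using assms(3) by (auto simp: subdivision_def)
    ultimately show "polytope C" "vertices C \<subseteq> vertices (?f ` P)"
      using polytope_affine_image[OF assms(1)]
      by (simp_all add: vertices_affine_image[OF assms(1,2)] image_mono)
    show "F \<in> (`) ?f ` S" if "F face_of C" for F using C that faces by blast
    show "(C \<inter> D) face_of C" "(C \<inter> D) face_of D" if "D \<in> (`) ?f ` S" for D
      using C that Int by blast+
  qed
qed

lemma interior_cells_affine_image:
  fixes A :: "'a::euclidean_space \<Rightarrow> 'a"
  assumes "linear A" "inj A"
  shows "interior_cells ((\<lambda>x. a + A x) ` P) ((`) (\<lambda>x. a + A x) ` S)
    = (`) (\<lambda>x. a + A x) ` interior_cells P S"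
proof -
  have inj: "inj (\<lambda>x. a + A x)" using assms(2) by (simp add: inj_def)
  show ?thesis
    by (auto simp: interior_cells_def rel_frontier_affine_image[OF assms] inj_image_subset_iff[OF inj])
qed

text \<open>Orthogonality makes \<open>A c\<close> the normal of the transported functional. One
  inclusion is enough, since \<open>iota\<close> is its own inverse and can be applied in either
  direction.\<close>

lemma induced_subdivision_affine_image:
  fixes A :: "'a::euclidean_space \<Rightarrow> 'a"
  assumes "orthogonal_transformation A"
  shows "(`) (\<lambda>x. a + A x) ` induced_subdivision P (\<lambda>x. h (a + A x))
    \<subseteq> induced_subdivision ((\<lambda>x. a + A x) ` P) h"
proof
  let ?f = "\<lambda>x. a + A x"
  let ?g = "\<lambda>z. (a, 0) + map_prod A id z :: 'a \<times> real"
  have A: "linear A" "inj A"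
    using assms by (auto simp: orthogonal_transformation_linear orthogonal_transformation_inj)
  have linA: "linear (map_prod A id :: _ \<Rightarrow> 'a \<times> real)"
    using A(1) by (auto simp: linear_iff)
  have L: "lifted_polytope (?f ` P) h = ?g ` lifted_polytope P (\<lambda>x. h (?f x))" (is "?M = ?g ` ?L")
  proof -
    have "?g ` ?L = (+) (a, 0) ` map_prod A id ` ?L" by (simp add: image_image)
    also have "\<dots> = ?M"
      unfolding lifted_polytope_def vertices_affine_image[OF A]
      by (simp add: convex_hull_linear_image[OF linA] convex_hull_translation[symmetric] image_image)
    finally show ?thesis by simp
  qed
  fix C assume "C \<in> (`) ?f ` induced_subdivision P (\<lambda>x. h (?f x))"
  then obtain c b where cb: "?L \<subseteq> {z. (c, 1) \<bullet> z \<ge> b}"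
    and C: "C = ?f ` fst ` (?L \<inter> {z. (c, 1) \<bullet> z = b})"
    by (auto simp: induced_subdivision_def lower_face_of_def)
  define b' where "b' = b + A c \<bullet> a"
  have eq: "(A c, 1) \<bullet> ?g z = (c, 1) \<bullet> z + A c \<bullet> a" for z
    using assms by (cases z) (simp add: orthogonal_transformation_def inner_add_right)
  have "?M \<subseteq> {z. (A c, 1) \<bullet> z \<ge> b'}"
  proof
    fix w assume "w \<in> ?M"
    then obtain z where "z \<in> ?L" "w = ?g z" unfolding L by blast
    then show "w \<in> {z. (A c, 1) \<bullet> z \<ge> b'}" using cb eq[of z] by (auto simp only: b'_def)
  qed
  moreover have "C = fst ` (?M \<inter> {z. (A c, 1) \<bullet> z = b'})"
  proof -
    have "?M \<inter> {z. (A c, 1) \<bullet> z = b'} = ?g ` (?L \<inter> {z. (c, 1) \<bullet> z = b})"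
      unfolding L using eq by (auto simp: b'_def simp del: inner_Pair)
    then show ?thesis unfolding C by (simp add: image_image)
  qed
  ultimately show "C \<in> induced_subdivision (?f ` P) h"
    unfolding induced_subdivision_def lower_face_of_def by blast
qed

section \<open>Integrality of the bipartite matching polytope\<close>

section \<open>Fractional matchings\<close>

definition edge_vertex :: "'k::finite \<times> 'm::finite \<Rightarrow> real^('k + 'm)" where
  "edge_vertex p = prod_vertex (fst p) (snd p)"

definition edge_ends :: "'k \<times> 'm \<Rightarrow> ('k + 'm) set" where
  "edge_ends p = {Inl (fst p), Inr (snd p)}"

text \<open>The incidence map of the complete bipartite graph.\<close>

definition edge_sum :: "real^('k::finite \<times> 'm::finite) \<Rightarrow> real^('k + 'm)" where
  "edge_sum t = (\<Sum>p\<in>UNIV. t $ p *\<^sub>R edge_vertex p)"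

text \<open>The linear relaxation of the matching polytope of the bipartite graph \<open>E\<close>;
  the bounds on \<open>edge_sum\<close> are the degree constraints.\<close>

definition fractional_matchings :: "('k::finite \<times> 'm::finite) set \<Rightarrow> (real^('k \<times> 'm)) set" where
  "fractional_matchings E =
     {t. (\<forall>p. 0 \<le> t $ p) \<and> (\<forall>p. p \<notin> E \<longrightarrow> t $ p = 0) \<and> (\<forall>l. edge_sum t $ l \<le> 1)}"

definition matching :: "('k \<times> 'm) set \<Rightarrow> bool" where
  "matching M \<longleftrightarrow> inj_on fst M \<and> inj_on snd M"

definition matching_vertex :: "('k::finite \<times> 'm::finite) set \<Rightarrow> real^('k + 'm)" where
  "matching_vertex M = (\<Sum>p\<in>M. edge_vertex p)"

lemma edge_vertex_nth: "edge_vertex p $ l = (if l \<in> edge_ends p then 1 else 0)"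
  by (cases l) (auto simp: edge_vertex_def edge_ends_def prod_vertex_def axis_def)

lemma card_edge_ends: "card (edge_ends p) = 2"
  by (simp add: edge_ends_def)

lemma linear_edge_sum: "linear edge_sum"
  by (rule linearI) (simp_all add: edge_sum_def scaleR_left_distrib sum.distrib scaleR_right.sum)

lemma edge_sum_nth: "edge_sum t $ l = (\<Sum>p | l \<in> edge_ends p. t $ p)"
proof -
  have "edge_sum t $ l = (\<Sum>p\<in>UNIV. if l \<in> edge_ends p then t $ p else 0)"
    unfolding edge_sum_def sum_component by (intro sum.cong) (auto simp: edge_vertex_nth)
  then show ?thesis by (simp add: sum.If_cases)
qed

lemma dim_supported:
  fixes A :: "'n::finite set"
  shows "dim {x::real^'n. \<forall>i. i \<notin> A \<longrightarrow> x $ i = 0} = card A"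
  using dim_substandard_cart[of A, where 'a = real] by (simp add: dim_vec_eq)

lemma subspace_supported: "subspace {x::real^'n. \<forall>i. i \<notin> A \<longrightarrow> x $ i = 0}"
  by (auto simp: subspace_def)

text \<open>Gives a step so short that moving with speeds \<open>\<beta> i\<close> exhausts none of
  the positive slacks \<open>\<alpha> i\<close>.\<close>

lemma small_scalar:
  fixes \<alpha> \<beta> :: "'i \<Rightarrow> real"
  assumes "finite I" "\<And>i. i \<in> I \<Longrightarrow> 0 < \<alpha> i"
  shows "\<exists>e>0. \<forall>i\<in>I. e * \<bar>\<beta> i\<bar> \<le> \<alpha> i"
  using assms
proof (induction I)
  case empty
  then show ?case by (intro exI[of _ 1]) auto
next
  case (insert i I)
  then obtain e where e: "e > 0" "\<And>j. j \<in> I \<Longrightarrow> e * \<bar>\<beta> j\<bar> \<le> \<alpha> j" by auto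
  \<comment> \<open>The summand 1 keeps the denominator positive when \<open>\<beta> i\<close> is
    0.\<close>
  define d where "d = min e (\<alpha> i / (\<bar>\<beta> i\<bar> + 1))"
  have "d > 0" using e insert by (simp add: d_def)
  moreover have "d * \<bar>\<beta> j\<bar> \<le> \<alpha> j" if "j \<in> I" for j
    using e(2)[OF that] mult_right_mono[of d e "\<bar>\<beta> j\<bar>"] by (auto simp: d_def)
  moreover have "d * \<bar>\<beta> i\<bar> \<le> \<alpha> i"
  proof -
    have "d * \<bar>\<beta> i\<bar> \<le> d * (\<bar>\<beta> i\<bar> + 1)" using \<open>d > 0\<close> by simp
    also have "\<dots> \<le> \<alpha> i / (\<bar>\<beta> i\<bar> + 1) * (\<bar>\<beta> i\<bar> + 1)"
      by (intro mult_right_mono) (auto simp: d_def)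
    also have "\<dots> = \<alpha> i" using abs_ge_zero[of "\<beta> i"] by (simp add: add_nonneg_eq_0_iff)
    finally show ?thesis .
  qed
  ultimately show ?case by auto
qed

text \<open>
  Double counting: every constraint in \<open>W\<close> involves at least two edges of \<open>\<Phi>\<close>, and every edge
  has two ends, so there are at most as many constraints as unknowns.  In case of equality all ends
  lie in \<open>W\<close>, and then the constraints are dependent, as summing them over the left ends and over
  the right ends gives the same result.
\<close>

lemma exists_balanced_direction:
  fixes \<Phi> :: "('k::finite \<times> 'm::finite) set"
  assumes "\<Phi> \<noteq> {}" and deg: "\<And>l. l \<in> W \<Longrightarrow> 2 \<le> card {p\<in>\<Phi>. l \<in> edge_ends p}"
  obtains d where "d \<noteq> 0" "\<And>p. p \<notin> \<Phi> \<Longrightarrow> d $ p = 0" "\<And>l. l \<in> W \<Longrightarrow> edge_sum d $ l = 0"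
proof -
  define S where "S = {d::real^('k \<times> 'm). \<forall>p. p \<notin> \<Phi> \<longrightarrow> d $ p = 0}"
  define U where "U = {y::real^('k + 'm). \<forall>l. l \<notin> W \<longrightarrow> y $ l = 0}"
  define g where "g d = (\<chi> l. if l \<in> W then edge_sum d $ l else 0)" for d :: "real^('k \<times> 'm)"
  have subS: "subspace S" and subU: "subspace U"
    unfolding S_def U_def by (rule subspace_supported)+
  have dimS: "dim S = card \<Phi>" and dimU: "dim U = card W"
    unfolding S_def U_def by (rule dim_supported)+
  have "linear g"
    by (rule linearI)
      (auto simp: g_def vec_eq_iff linear_add[OF linear_edge_sum] linear_cmul[OF linear_edge_sum])
  have gU: "g ` S \<subseteq> U" by (auto simp: g_def U_def)
  have "2 * card W = (\<Sum>l\<in>W. 2)" by simp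
  also have "\<dots> \<le> (\<Sum>l\<in>W. card {p\<in>\<Phi>. l \<in> edge_ends p})"
    by (intro sum_mono deg)
  also have "\<dots> = (\<Sum>p\<in>\<Phi>. card {l\<in>W. l \<in> edge_ends p})"
    by (rule sum_multicount_gen) auto
  finally have le: "2 * card W \<le> (\<Sum>p\<in>\<Phi>. card {l\<in>W. l \<in> edge_ends p})" .
  have card2: "card {l\<in>W. l \<in> edge_ends p} \<le> 2" for p
    using card_mono[of "edge_ends p" "{l\<in>W. l \<in> edge_ends p}"] by (auto simp: card_edge_ends)
  have "\<not> inj_on g S"
  proof
    assume inj: "inj_on g S"
    have "dim (g ` S) = card \<Phi>"
      using dim_image_eq[OF \<open>linear g\<close>, of S] inj subS dimS
      by (simp add: span_eq_iff[THEN iffD2])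
    then have "card \<Phi> \<le> card W" using dim_subset[OF gU] dimU by simp
    then have ge: "(\<Sum>p\<in>\<Phi>. 2) \<le> (\<Sum>p\<in>\<Phi>. card {l\<in>W. l \<in> edge_ends p})" using le by simp
    have ends: "edge_ends p \<subseteq> W" if "p \<in> \<Phi>" for p
    proof -
      have "card {l\<in>W. l \<in> edge_ends p} = 2"
      proof (rule ccontr)
        assume "card {l\<in>W. l \<in> edge_ends p} \<noteq> 2"
        then have "card {l\<in>W. l \<in> edge_ends p} < 2" using card2[of p] by simp
        then have "(\<Sum>p\<in>\<Phi>. card {l\<in>W. l \<in> edge_ends p}) < (\<Sum>p\<in>\<Phi>. 2)"
          using card2 that by (intro sum_strict_mono_ex1) auto
        then show False using ge by simp
      qed
      then have "{l\<in>W. l \<in> edge_ends p} = edge_ends p"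
        by (intro card_subset_eq) (auto simp: card_edge_ends)
      then show ?thesis by blast
    qed
    have "card W \<le> card \<Phi>"
    proof -
      have "(\<Sum>p\<in>\<Phi>. card {l\<in>W. l \<in> edge_ends p}) \<le> (\<Sum>p\<in>\<Phi>. 2)" by (intro sum_mono card2)
      then show ?thesis using le by simp
    qed
    \<comment> \<open>Equal dimensions make \<open>g\<close> map \<open>S\<close> onto
      \<open>U\<close>, so the unit vector at the left end of an edge would have a preimage. The
      contradiction is that this vector has left total 1 and right total 0.\<close>
    then have "g ` S = U"
      using subspace_dim_equal[OF linear_subspace_image[OF \<open>linear g\<close> subS] subU gU]
        \<open>dim (g ` S) = card \<Phi>\<close> dimU by simp
    moreover obtain p where "p \<in> \<Phi>" using assms(1) by auto
    ultimately obtain d where d: "d \<in> S" "g d = axis (Inl (fst p)) 1"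
    proof -
      have "axis (Inl (fst p)) 1 \<in> U"
        using ends[OF \<open>p \<in> \<Phi>\<close>] by (auto simp: U_def edge_ends_def axis_def)
      then show thesis using that \<open>g ` S = U\<close> by (metis imageE)
    qed
    have g: "g d = edge_sum d"
    proof -
      have "edge_sum d $ l = 0" if "l \<notin> W" for l
        unfolding edge_sum_nth
      proof (intro sum.neutral ballI)
        fix q assume "q \<in> {q. l \<in> edge_ends q}"
        then have "q \<notin> \<Phi>" using ends[of q] that by blast
        then show "d $ q = 0" using d(1) unfolding S_def by blast
      qed
      then show ?thesis by (simp add: g_def vec_eq_iff)
    qed
    have "(\<Sum>i\<in>UNIV. edge_sum d $ Inl i) = (\<Sum>j\<in>UNIV. edge_sum d $ Inr j)"
    proof -
      have "(\<Sum>i\<in>UNIV. edge_sum d $ Inl i) = (\<Sum>i\<in>UNIV. \<Sum>p\<in>UNIV. if fst p = i then d $ p else 0)"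
        by (intro sum.cong) (auto simp: edge_sum_nth edge_ends_def sum.If_cases intro!: sum.cong)
      also have "\<dots> = (\<Sum>p\<in>UNIV. d $ p)" by (subst sum.swap) simp
      also have "\<dots> = (\<Sum>j\<in>UNIV. \<Sum>p\<in>UNIV. if snd p = j then d $ p else 0)"
        by (subst sum.swap) simp
      also have "\<dots> = (\<Sum>j\<in>UNIV. edge_sum d $ Inr j)"
        by (intro sum.cong) (auto simp: edge_sum_nth edge_ends_def sum.If_cases intro!: sum.cong)
      finally show ?thesis .
    qed
    then show False using d g by (simp add: axis_def)
  qed
  then obtain a b where ab: "a \<in> S" "b \<in> S" "g a = g b" "a \<noteq> b" by (auto simp: inj_on_def)
  show thesis
  proof
    show "a - b \<noteq> 0" using ab by simp
    show "(a - b) $ p = 0" if "p \<notin> \<Phi>" for p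
      using subspace_diff[OF subS ab(1,2)] that unfolding S_def by blast
    have "g (a - b) = 0" using ab linear_diff[OF \<open>linear g\<close>] by simp
    then show "edge_sum (a - b) $ l = 0" if "l \<in> W" for l
      using that by (simp add: g_def vec_eq_iff split: if_splits)
  qed
qed

text \<open>If \<open>t\<close> had a fractional coordinate, it could be moved both ways along a
  direction that is supported on the fractional edges and keeps all tight degree constraints, so it
  would be the midpoint of two fractional matchings.\<close>

lemma extreme_fractional_matching:
  assumes "t extreme_point_of fractional_matchings E"
  shows "t $ p \<in> {0, 1}"
proof (rule ccontr)
  assume nin: "t $ p \<notin> {0, 1}"
  define \<Phi> where "\<Phi> = {p. t $ p \<notin> {0, 1}}"
  \<comment> \<open>Only tight constraints that meet a fractional edge are imposed; the other tight
    ones are kept because \<open>d\<close> vanishes on all edges at them.\<close>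
  define W where "W = {l. edge_sum t $ l = 1 \<and> (\<exists>p\<in>\<Phi>. l \<in> edge_ends p)}"
  have "t \<in> fractional_matchings E" using assms by (simp add: extreme_point_of_def)
  then have t: "\<And>p. 0 \<le> t $ p" "\<And>p. p \<notin> E \<Longrightarrow> t $ p = 0" "\<And>l. edge_sum t $ l \<le> 1"
    by (auto simp: fractional_matchings_def)
  have le1: "t $ p \<le> 1" for p
  proof -
    have "t $ p \<le> edge_sum t $ Inl (fst p)"
      unfolding edge_sum_nth by (rule member_le_sum) (auto simp: edge_ends_def t)
    then show ?thesis using t(3) order_trans by blast
  qed
  have \<Phi>: "0 < t $ p" "t $ p < 1" if "p \<in> \<Phi>" for p
    using that t(1)[of p] le1[of p] by (auto simp: \<Phi>_def)
  have "2 \<le> card {p\<in>\<Phi>. l \<in> edge_ends p}" if l: "l \<in> W" for l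
  proof (rule ccontr)
    assume "\<not> 2 \<le> card {p\<in>\<Phi>. l \<in> edge_ends p}"
    then have "card {p\<in>\<Phi>. l \<in> edge_ends p} \<le> Suc 0" by simp
    moreover obtain q where q: "q \<in> \<Phi>" "l \<in> edge_ends q" using l by (auto simp: W_def)
    ultimately have only: "r = q" if "r \<in> \<Phi>" "l \<in> edge_ends r" for r
      using that card_le_Suc0_iff_eq[of "{p\<in>\<Phi>. l \<in> edge_ends p}", OF finite] by blast
    have "1 = (\<Sum>r | l \<in> edge_ends r. t $ r)" using l by (simp add: W_def edge_sum_nth)
    also have "\<dots> = t $ q + (\<Sum>r\<in>{r. l \<in> edge_ends r} - {q}. t $ r)"
      using q by (intro sum.remove) auto
    finally have "t $ q = 1 - (\<Sum>r\<in>{r. l \<in> edge_ends r} - {q}. t $ r)" by simp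
    \<comment> \<open>If \<open>q\<close> were the only fractional edge at \<open>l\<close>, its
      weight would be 1 minus an integer.\<close>
    moreover have "(\<Sum>r\<in>{r. l \<in> edge_ends r} - {q}. t $ r) \<in> \<int>"
    proof (rule Ints_sum)
      fix r assume "r \<in> {r. l \<in> edge_ends r} - {q}"
      then have "t $ r \<in> {0, 1}" using only[of r] by (auto simp: \<Phi>_def)
      then show "t $ r \<in> \<int>" by auto
    qed
    ultimately have "t $ q \<in> \<int>" by auto
    then show False using \<Phi>[OF q(1)] by (auto elim!: Ints_cases)
  qed
  moreover have "\<Phi> \<noteq> {}" using nin unfolding \<Phi>_def by blast
  ultimately obtain d
    where d: "d \<noteq> 0" "\<And>p. p \<notin> \<Phi> \<Longrightarrow> d $ p = 0" "\<And>l. l \<in> W \<Longrightarrow> edge_sum d $ l = 0"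
    using exists_balanced_direction[of \<Phi> W] by blast
  obtain e1 where e1: "e1 > 0" "\<And>p. p \<in> \<Phi> \<Longrightarrow> e1 * \<bar>d $ p\<bar> \<le> t $ p"
    using small_scalar[of \<Phi> "\<lambda>p. t $ p" "\<lambda>p. d $ p"] \<Phi> by auto
  obtain e2 where e2: "e2 > 0"
    "\<And>l. edge_sum t $ l < 1 \<Longrightarrow> e2 * \<bar>edge_sum d $ l\<bar> \<le> 1 - edge_sum t $ l"
    using small_scalar[of "{l. edge_sum t $ l < 1}" "\<lambda>l. 1 - edge_sum t $ l" "\<lambda>l. edge_sum d $ l"]
    by auto
  have dW: "edge_sum d $ l = 0" if "edge_sum t $ l = 1" for l
  proof (cases "l \<in> W")
    case False
    then show ?thesis unfolding edge_sum_nth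
      using that by (intro sum.neutral) (auto simp: W_def d)
  qed (simp add: d)
  define e where "e = min e1 e2"
  have e: "e > 0" using e1 e2 by (simp add: e_def)
  have mem: "t + s *\<^sub>R d \<in> fractional_matchings E" if "\<bar>s\<bar> = e" for s
    unfolding fractional_matchings_def
  proof (intro CollectI conjI allI impI)
    fix p
    have "\<bar>s * d $ p\<bar> \<le> t $ p"
    proof (cases "p \<in> \<Phi>")
      case True
      have "\<bar>s * d $ p\<bar> \<le> e1 * \<bar>d $ p\<bar>"
        unfolding abs_mult that by (intro mult_right_mono) (auto simp: e_def)
      then show ?thesis using e1(2)[OF True] by simp
    qed (simp add: d t)
    then show "0 \<le> (t + s *\<^sub>R d) $ p" by simp
    show "(t + s *\<^sub>R d) $ p = 0" if "p \<notin> E"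
    proof -
      have "p \<notin> \<Phi>" using t(2)[OF that] by (simp add: \<Phi>_def)
      then show ?thesis using t(2)[OF that] by (simp add: d)
    qed
  next
    fix l
    have "\<bar>s * edge_sum d $ l\<bar> \<le> 1 - edge_sum t $ l"
    proof (cases "edge_sum t $ l = 1")
      case True
      then show ?thesis by (simp add: dW)
    next
      case False
      have "\<bar>s * edge_sum d $ l\<bar> \<le> e2 * \<bar>edge_sum d $ l\<bar>"
        unfolding abs_mult that by (intro mult_right_mono) (auto simp: e_def)
      then show ?thesis using e2(2)[of l] False t(3)[of l] by simp
    qed
    then show "edge_sum (t + s *\<^sub>R d) $ l \<le> 1"
      by (simp add: linear_add[OF linear_edge_sum] linear_cmul[OF linear_edge_sum])
  qed
  have "t = midpoint (t + e *\<^sub>R d) (t + (-e) *\<^sub>R d)"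
    by (simp add: midpoint_def algebra_simps flip: scaleR_2)
  moreover have "t + e *\<^sub>R d \<noteq> t + (-e) *\<^sub>R d"
  proof
    assume "t + e *\<^sub>R d = t + (-e) *\<^sub>R d"
    then have "(e - (-e)) *\<^sub>R d = 0" unfolding scaleR_left_diff_distrib by (simp only: add_left_cancel) simp
    then show False using e d(1) by simp
  qed
  ultimately have "t \<in> open_segment (t + e *\<^sub>R d) (t + (-e) *\<^sub>R d)"
    using midpoint_in_open_segment by metis
  then show False
    using assms mem[of e] mem[of "-e"] e unfolding extreme_point_of_def by auto
qed

lemma edge_sum_indicator: "edge_sum (\<chi> p. if p \<in> M then 1 else 0) = matching_vertex M"
proof -
  have "edge_sum (\<chi> p. if p \<in> M then 1 else 0) = (\<Sum>p\<in>UNIV. if p \<in> M then edge_vertex p else 0)"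
    unfolding edge_sum_def by (intro sum.cong) auto
  then show ?thesis by (simp add: sum.If_cases matching_vertex_def)
qed

lemma matching_vertex_nth: "matching_vertex M $ l = real (card {p\<in>M. l \<in> edge_ends p})"
  unfolding edge_sum_indicator[symmetric] edge_sum_nth
  by (simp add: sum.If_cases Int_def conj_commute)

lemma matching_iff: "matching M \<longleftrightarrow> (\<forall>l. card {p\<in>M. l \<in> edge_ends p} \<le> 1)"
  for M :: "('k::finite \<times> 'm::finite) set"
proof -
  have "card {p\<in>M. l \<in> edge_ends p} \<le> 1 \<longleftrightarrow>
    (\<forall>p\<in>M. \<forall>q\<in>M. l \<in> edge_ends p \<longrightarrow> l \<in> edge_ends q \<longrightarrow> p = q)" for l
    using card_le_Suc0_iff_eq[of "{p\<in>M. l \<in> edge_ends p}"] by auto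
  then have "(\<forall>l. card {p\<in>M. l \<in> edge_ends p} \<le> 1) \<longleftrightarrow>
    (\<forall>l. \<forall>p\<in>M. \<forall>q\<in>M. l \<in> edge_ends p \<longrightarrow> l \<in> edge_ends q \<longrightarrow> p = q)"
    by simp
  also have "\<dots> \<longleftrightarrow> matching M"
    unfolding matching_def inj_on_def edge_ends_def split_sum_all by blast
  finally show ?thesis by simp
qed

lemma convex_fractional_matchings: "convex (fractional_matchings E)"
  unfolding fractional_matchings_def convex_alt
  by (auto simp: linear_add[OF linear_edge_sum] linear_cmul[OF linear_edge_sum]
      intro!: add_nonneg_nonneg convex_bound_le)

lemma compact_fractional_matchings: "compact (fractional_matchings E)"
proof -
  have "fractional_matchings E \<subseteq> cbox 0 1"
  proof
    fix t assume t: "t \<in> fractional_matchings E"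
    have "t $ p \<le> 1" for p
    proof -
      have "t $ p \<le> edge_sum t $ Inl (fst p)"
        unfolding edge_sum_nth using t
        by (intro member_le_sum) (auto simp: edge_ends_def fractional_matchings_def)
      also have "\<dots> \<le> 1" using t by (simp add: fractional_matchings_def)
      finally show ?thesis .
    qed
    then show "t \<in> cbox 0 1" using t by (simp add: mem_box_cart fractional_matchings_def)
  qed
  moreover have "closed (fractional_matchings E)"
  proof -
    have "continuous_on UNIV edge_sum"
      by (intro linear_continuous_on linear_edge_sum[unfolded linear_conv_bounded_linear])
    then show ?thesis
      unfolding fractional_matchings_def
      by (intro closed_Collect_conj closed_Collect_all closed_Collect_imp closed_Collect_le
          closed_Collect_eq open_Collect_const continuous_on_component continuous_on_id
          continuous_on_const)
  qed
  ultimately show ?thesis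
    using bounded_subset[OF bounded_cbox] compact_eq_bounded_closed by blast
qed

text \<open>By Krein-Milman it suffices to look at extreme points, and these are indicator vectors
  of matchings.\<close>

lemma edge_sum_fractional_matchings:
  "edge_sum ` fractional_matchings E \<subseteq> convex hull (matching_vertex ` {M. M \<subseteq> E \<and> matching M})"
proof -
  let ?X = "{t. t extreme_point_of fractional_matchings E}"
  have "edge_sum ` ?X \<subseteq> matching_vertex ` {M. M \<subseteq> E \<and> matching M}"
  proof
    fix x assume "x \<in> edge_sum ` ?X"
    then obtain t where t: "t extreme_point_of fractional_matchings E" "x = edge_sum t" by auto
    then have tm: "t \<in> fractional_matchings E" by (simp add: extreme_point_of_def)
    define M where "M = {p. t $ p = 1}"
    have "t = (\<chi> p. if p \<in> M then 1 else 0)"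
      using extreme_fractional_matching[OF t(1)] by (auto simp: vec_eq_iff M_def)
    then have x: "x = matching_vertex M" using t edge_sum_indicator by metis
    have "real (card {p\<in>M. l \<in> edge_ends p}) \<le> 1" for l
      using tm t(2) x by (simp add: fractional_matchings_def flip: matching_vertex_nth)
    then have "matching M" by (simp add: matching_iff)
    moreover have "M \<subseteq> E" using tm by (fastforce simp: M_def fractional_matchings_def)
    ultimately show "x \<in> matching_vertex ` {M. M \<subseteq> E \<and> matching M}" using x by blast
  qed
  then have "convex hull (edge_sum ` ?X)
      \<subseteq> convex hull (matching_vertex ` {M. M \<subseteq> E \<and> matching M})"
    by (rule hull_mono)
  moreover have "fractional_matchings E = convex hull ?X"
    by (rule Krein_Milman_Minkowski[OF compact_fractional_matchings convex_fractional_matchings])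
  then have "edge_sum ` fractional_matchings E = convex hull (edge_sum ` ?X)"
    using convex_hull_linear_image[OF linear_edge_sum, of ?X] by simp
  ultimately show ?thesis by simp
qed

section \<open>Radial projection, and truncated cones as hulls of matchings\<close>

section \<open>Truncated cones\<close>

text \<open>The radial coordinate: 0 at the apex and 1 on the product of simplices. At a point
  corresponding to a vertex of the hypersimplex it counts the elements of
  \<open>initial_block\<close> missing from that vertex.\<close>

definition left_sum :: "real^('k::finite + 'm::finite) \<Rightarrow> real" where
  "left_sum x = (\<Sum>i\<in>UNIV. x $ Inl i)"

definition right_sum :: "real^('k::finite + 'm::finite) \<Rightarrow> real" where
  "right_sum x = (\<Sum>j\<in>UNIV. x $ Inr j)"

text \<open>
  The cone over \<open>F\<close> with apex \<open>0\<close> inside the unit cube, for \<open>F\<close> in the hyperplane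
  \<open>left_sum x = 1\<close>.  The apex is included even if \<open>F\<close> is empty.
\<close>

definition truncated_cone :: "(real^('k::finite + 'm::finite)) set \<Rightarrow> (real^('k + 'm)) set" where
  "truncated_cone F =
     {x. (\<forall>l. x $ l \<le> 1) \<and> (x = 0 \<or> 0 < left_sum x \<and> x /\<^sub>R left_sum x \<in> F)}"

lemma linear_left_sum: "linear left_sum"
  by (rule linearI) (simp_all add: left_sum_def sum.distrib sum_distrib_left)

lemma linear_right_sum: "linear right_sum"
  by (rule linearI) (simp_all add: right_sum_def sum.distrib sum_distrib_left)

lemmas left_sum_simps [simp] = linear_add[OF linear_left_sum] linear_cmul[OF linear_left_sum]
  linear_0[OF linear_left_sum]
lemmas right_sum_simps [simp] = linear_add[OF linear_right_sum] linear_cmul[OF linear_right_sum]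
  linear_0[OF linear_right_sum]

lemma edge_sum_Inl: "edge_sum t $ Inl i = (\<Sum>j\<in>UNIV. t $ (i, j))"
  for t :: "real^('k::finite \<times> 'm::finite)"
proof -
  have "{p :: 'k \<times> 'm. Inl i \<in> edge_ends p} = (\<lambda>j. (i, j)) ` UNIV" by (auto simp: edge_ends_def)
  then show ?thesis unfolding edge_sum_nth by (simp add: sum.reindex inj_on_def)
qed

lemma edge_sum_Inr: "edge_sum t $ Inr j = (\<Sum>i\<in>UNIV. t $ (i, j))"
  for t :: "real^('k::finite \<times> 'm::finite)"
proof -
  have "{p :: 'k \<times> 'm. Inr j \<in> edge_ends p} = (\<lambda>i. (i, j)) ` UNIV" by (auto simp: edge_ends_def)
  then show ?thesis unfolding edge_sum_nth by (simp add: sum.reindex inj_on_def)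
qed

lemma left_sum_edge_vertex [simp]: "left_sum (edge_vertex p) = 1"
  by (simp add: left_sum_def edge_vertex_nth edge_ends_def)

lemma right_sum_edge_vertex [simp]: "right_sum (edge_vertex p) = 1"
  by (simp add: right_sum_def edge_vertex_nth edge_ends_def)

lemma left_sum_matching_vertex: "left_sum (matching_vertex M) = real (card M)"
  by (simp add: matching_vertex_def linear_sum[OF linear_left_sum])

lemma simplex_product_hull: "simplex_product = convex hull range edge_vertex"
  by (simp add: simplex_product_def edge_vertex_def image_def)

lemma simplex_product_eq:
  "simplex_product = {x. left_sum x = 1 \<and> right_sum x = 1 \<and> (\<forall>l. 0 \<le> x $ l)}" (is "_ = ?R")
proof
  have "convex ?R" unfolding convex_def by simp
  then show "simplex_product \<subseteq> ?R"
    unfolding simplex_product_hull by (intro hull_minimal) (auto simp: edge_vertex_nth)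
  show "?R \<subseteq> simplex_product"
  proof
    fix x :: "real^('a + 'b)" assume x: "x \<in> ?R"
    \<comment> \<open>The product coupling: its two marginals are the left and the right block of
      \<open>x\<close>.\<close>
    define t :: "real^('a \<times> 'b)" where "t = (\<chi> p. x $ Inl (fst p) * x $ Inr (snd p))"
    have "edge_sum t $ l = x $ l" for l
    proof (cases l)
      case (Inl i)
      have "edge_sum t $ Inl i = x $ Inl i * right_sum x"
        unfolding edge_sum_Inl right_sum_def by (simp add: t_def sum_distrib_left)
      then show ?thesis using x Inl by simp
    next
      case (Inr j)
      have "edge_sum t $ Inr j = left_sum x * x $ Inr j"
        unfolding edge_sum_Inr left_sum_def by (simp add: t_def sum_distrib_right)
      then show ?thesis using x Inr by simp
    qed
    then have xt: "x = edge_sum t" by (simp add: vec_eq_iff)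
    moreover have "left_sum (edge_sum t) = (\<Sum>p\<in>UNIV. t $ p)"
      by (simp add: edge_sum_def linear_sum[OF linear_left_sum])
    ultimately have "(\<Sum>p\<in>UNIV. t $ p) = 1" using x by simp
    moreover have "0 \<le> t $ p" for p using x by (simp add: t_def)
    ultimately show "x \<in> simplex_product"
      unfolding xt edge_sum_def simplex_product_hull
      by (intro convex_sum) (auto intro: hull_inc)
  qed
qed

lemma polytope_simplex_product: "polytope simplex_product"
  unfolding simplex_product_hull by (intro polytope_convex_hull) simp

lemma simplex_product_nonempty: "simplex_product \<noteq> {}"
  unfolding simplex_product_hull by simp

lemma truncated_cone_Int: "truncated_cone (F \<inter> G) = truncated_cone F \<inter> truncated_cone G"
  by (auto simp: truncated_cone_def)

lemma truncated_cone_mono: "F \<subseteq> G \<Longrightarrow> truncated_cone F \<subseteq> truncated_cone G"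
  by (auto simp: truncated_cone_def)

lemma zero_in_truncated_cone [simp]: "0 \<in> truncated_cone F"
  by (simp add: truncated_cone_def)

lemma truncated_cone_left_sum_pos:
  assumes "x \<in> truncated_cone F" "x \<noteq> 0"
  shows "0 < left_sum x" "x /\<^sub>R left_sum x \<in> F"
  using assms by (auto simp: truncated_cone_def)

lemma normalize_scaleR:
  assumes "v \<noteq> 0"
  shows "(v *\<^sub>R y) /\<^sub>R left_sum (v *\<^sub>R y) = y /\<^sub>R left_sum y"
proof -
  have "inverse (v * left_sum y) * v = inverse v * v * inverse (left_sum y)"
    by (simp only: inverse_mult_distrib ac_simps)
  then show ?thesis using assms by simp
qed

text \<open>The radial projection of a combination is a combination of the radial projections. If
  \<open>s\<close> is the left sum of the combination, the new weights add up to 1.\<close>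

lemma normalize_combination:
  assumes "0 < left_sum a" "0 < left_sum b" "0 < s"
  shows "(u *\<^sub>R a + v *\<^sub>R b) /\<^sub>R s = (u * left_sum a / s) *\<^sub>R (a /\<^sub>R left_sum a)
    + (v * left_sum b / s) *\<^sub>R (b /\<^sub>R left_sum b)"
proof -
  have "inverse s * u = u * left_sum a / s * inverse (left_sum a)"
    "inverse s * v = v * left_sum b / s * inverse (left_sum b)"
    using assms by (simp_all add: field_simps)
  then show ?thesis by (simp add: scaleR_right_distrib)
qed

lemma convex_truncated_cone:
  assumes "convex F"
  shows "convex (truncated_cone F)"
  unfolding convex_def
proof (intro ballI allI impI)
  fix x y and u v :: real
  assume x: "x \<in> truncated_cone F" and y: "y \<in> truncated_cone F"
    and uv: "0 \<le> u" "0 \<le> v" "u + v = 1"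
  define z where "z = u *\<^sub>R x + v *\<^sub>R y"
  have "z $ l \<le> 1" for l
    using x y uv convex_bound_le[of "x $ l" 1 "y $ l" u v] by (simp add: z_def truncated_cone_def)
  moreover have "0 < left_sum z \<and> z /\<^sub>R left_sum z \<in> F" if "z \<noteq> 0"
  \<comment> \<open>The apex has no radial projection; if one summand vanishes, \<open>z\<close>
    lies on the ray of the other.\<close>
  proof (cases "u *\<^sub>R x = 0 \<or> v *\<^sub>R y = 0")
    case True
    then show ?thesis
    proof
      assume "u *\<^sub>R x = 0"
      then have z: "z = v *\<^sub>R y" by (simp only: z_def) simp
      then have nz: "v \<noteq> 0" "y \<noteq> 0" using that by auto
      moreover from this have "0 < left_sum z"
        using z uv truncated_cone_left_sum_pos(1)[OF y] by simp
      moreover have "z /\<^sub>R left_sum z = y /\<^sub>R left_sum y"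
        unfolding z using nz(1) by (rule normalize_scaleR)
      ultimately show ?thesis using truncated_cone_left_sum_pos(2)[OF y] by simp
    next
      assume "v *\<^sub>R y = 0"
      then have z: "z = u *\<^sub>R x" by (simp only: z_def) simp
      then have nz: "u \<noteq> 0" "x \<noteq> 0" using that by auto
      moreover from this have "0 < left_sum z"
        using z uv truncated_cone_left_sum_pos(1)[OF x] by simp
      moreover have "z /\<^sub>R left_sum z = x /\<^sub>R left_sum x"
        unfolding z using nz(1) by (rule normalize_scaleR)
      ultimately show ?thesis using truncated_cone_left_sum_pos(2)[OF x] by simp
    qed
  next
    case False
    then have uv': "0 < u" "0 < v" and xy: "x \<noteq> 0" "y \<noteq> 0" using uv by auto
    note px = truncated_cone_left_sum_pos[OF x xy(1)] and py = truncated_cone_left_sum_pos[OF y xy(2)]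
    have pos: "0 < left_sum z" using px py uv' by (simp add: z_def add_pos_pos)
    have "z /\<^sub>R left_sum z = (u * left_sum x / left_sum z) *\<^sub>R (x /\<^sub>R left_sum x)
        + (v * left_sum y / left_sum z) *\<^sub>R (y /\<^sub>R left_sum y)"
      unfolding z_def using px py pos[unfolded z_def] by (intro normalize_combination)
    also have "\<dots> \<in> F"
      using assms px py uv' pos
      by (intro convexD) (auto simp: z_def simp flip: add_divide_distrib)
    finally show ?thesis using pos by simp
  qed
  ultimately show "u *\<^sub>R x + v *\<^sub>R y \<in> truncated_cone F"
    by (auto simp: truncated_cone_def z_def)
qed

text \<open>Radial projection sends an open segment between nonzero points into an open segment or
  to a single point, so the face property of \<open>F'\<close> carries over to the cone.\<close>

lemma truncated_cone_face:
  assumes "F' face_of F"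
  shows "truncated_cone F' face_of truncated_cone F"
proof -
  \<comment> \<open>One end is enough: exchanging \<open>u\<close> with \<open>1 - u\<close> gives
    the other.\<close>
  have *: "a \<in> truncated_cone F'"
    if a: "a \<in> truncated_cone F" and b: "b \<in> truncated_cone F" and x: "x \<in> truncated_cone F'"
      and u: "0 < u" "u < 1" "x = (1 - u) *\<^sub>R a + u *\<^sub>R b" for a b x u
  proof (cases "a = 0")
    case False
    note pa = truncated_cone_left_sum_pos[OF a False]
    have "0 \<le> left_sum b" using truncated_cone_left_sum_pos[OF b] by (cases "b = 0") auto
    moreover have lx: "left_sum x = (1 - u) * left_sum a + u * left_sum b" using u(3) by simp
    moreover have pa': "0 < (1 - u) * left_sum a" using pa u by simp
    ultimately have pos: "0 < left_sum x" using u by (simp add: add_pos_nonneg)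
    then have xF: "x /\<^sub>R left_sum x \<in> F'"
      using truncated_cone_left_sum_pos[OF x] by (cases "x = 0") auto
    have "a /\<^sub>R left_sum a \<in> F'"
    proof (cases "b = 0")
      case True
      then have "x /\<^sub>R left_sum x = a /\<^sub>R left_sum a"
        using u normalize_scaleR[of "1 - u" a] by simp
      then show ?thesis using xF by simp
    next
      case False
      note pb = truncated_cone_left_sum_pos[OF b False]
      define w where "w = u * left_sum b / left_sum x"
      have w: "0 < w" "w < 1" "1 - w = (1 - u) * left_sum a / left_sum x"
        using pos pb u(1,2) pa' unfolding w_def by (simp_all add: lx field_simps)
      have "x /\<^sub>R left_sum x = (1 - w) *\<^sub>R (a /\<^sub>R left_sum a) + w *\<^sub>R (b /\<^sub>R left_sum b)"
        unfolding w(3) unfolding w_def using normalize_combination[OF pa(1) pb(1) pos] u(3) by metis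
      \<comment> \<open>If \<open>a\<close> and \<open>b\<close> lie on one ray, their projections
        coincide and the open segment between these is empty.\<close>
      then have "x /\<^sub>R left_sum x = a /\<^sub>R left_sum a
          \<or> x /\<^sub>R left_sum x \<in> open_segment (a /\<^sub>R left_sum a) (b /\<^sub>R left_sum b)"
      proof -
        have "X = A \<or> X \<in> open_segment A B" if "X = (1 - w) *\<^sub>R A + w *\<^sub>R B"
          for X A B :: "real^('a + 'b)"
          using that w(1,2) by (cases "A = B") (auto simp: in_segment algebra_simps)
        then show ?thesis using \<open>x /\<^sub>R left_sum x = _\<close> by blast
      qed
      then show ?thesis using xF pa pb assms unfolding face_of_def by metis
    qed
    then show ?thesis using a pa by (simp add: truncated_cone_def)
  qed simp
  show ?thesis
    unfolding face_of_def
  proof (intro conjI ballI impI)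
    show "truncated_cone F' \<subseteq> truncated_cone F"
      using truncated_cone_mono face_of_imp_subset[OF assms] .
    show "convex (truncated_cone F')"
      using convex_truncated_cone face_of_imp_convex[OF assms] .
    fix a b x
    assume abx: "a \<in> truncated_cone F" "b \<in> truncated_cone F" "x \<in> truncated_cone F'"
      and "x \<in> open_segment a b"
    then obtain u where u: "0 < u" "u < 1" "x = (1 - u) *\<^sub>R a + u *\<^sub>R b"
      by (auto simp: in_segment)
    show "a \<in> truncated_cone F'" using *[OF abx u] .
    show "b \<in> truncated_cone F'" using *[OF abx(2,1,3), of "1 - u"] u by (simp add: add.commute)
  qed
qed

text \<open>On the slice each coordinate is bounded by its block sum 1, so the truncation removes
  nothing there, and normalisation is the identity.\<close>

lemma truncated_cone_Int_simplex_product: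
  assumes "F \<subseteq> simplex_product"
  shows "truncated_cone F \<inter> simplex_product = F"
proof -
  have le1: "x $ l \<le> 1" if x: "x \<in> simplex_product" for x :: "real^('a + 'b)" and l
  proof (cases l)
    case (Inl i)
    have "x $ Inl i \<le> left_sum x"
      unfolding left_sum_def using x by (intro member_le_sum) (auto simp: simplex_product_eq)
    then show ?thesis using x Inl by (simp add: simplex_product_eq)
  next
    case (Inr j)
    have "x $ Inr j \<le> right_sum x"
      unfolding right_sum_def using x by (intro member_le_sum) (auto simp: simplex_product_eq)
    then show ?thesis using x Inr by (simp add: simplex_product_eq)
  qed
  have "x \<in> truncated_cone F \<longleftrightarrow> x \<in> F" if x: "x \<in> simplex_product" for x
  proof -
    have "left_sum x = 1" using x by (simp add: simplex_product_eq)
    moreover from this have "x \<noteq> 0" by auto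
    ultimately show ?thesis using le1[OF x] by (simp add: truncated_cone_def)
  qed
  then show ?thesis using assms by blast
qed

lemma matching_vertex_zero_one:
  assumes "matching M"
  shows "matching_vertex M $ l \<in> {0, 1}"
proof -
  have "card {p\<in>M. l \<in> edge_ends p} \<le> 1" using assms by (simp add: matching_iff)
  then have "card {p\<in>M. l \<in> edge_ends p} = 0 \<or> card {p\<in>M. l \<in> edge_ends p} = 1" by linarith
  then show ?thesis unfolding matching_vertex_nth by (elim disjE; simp only:) simp_all
qed

text \<open>Scaling the edge weights by \<open>left_sum x\<close> turns the bounds
  \<open>x $ l \<le> 1\<close> into the degree constraints of a fractional matching, and integrality
  gives one inclusion. For the other, a nonempty matching projects radially to the barycentre of its
  edges.\<close>

lemma truncated_cone_hull:
  fixes E :: "('k::finite \<times> 'm::finite) set"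
  shows
  "truncated_cone (convex hull (edge_vertex ` E)) =
    convex hull (matching_vertex ` {M. M \<subseteq> E \<and> matching M})" (is "?L = ?R")
proof
  show "?R \<subseteq> ?L"
  proof (rule hull_minimal)
    show "convex ?L" by (intro convex_truncated_cone) simp
    show "matching_vertex ` {M. M \<subseteq> E \<and> matching M} \<subseteq> ?L"
    proof clarify
      fix M assume M: "M \<subseteq> E" "matching M"
      have "matching_vertex M $ l \<le> 1" for l
        using matching_vertex_zero_one[OF M(2), of l] by auto
      moreover have "matching_vertex M = 0 \<or> 0 < left_sum (matching_vertex M) \<and>
        matching_vertex M /\<^sub>R left_sum (matching_vertex M) \<in> convex hull (edge_vertex ` E)"
      proof (cases "M = {}")
        case True
        then show ?thesis by (simp add: matching_vertex_def)
      next
        case False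
        then have pos: "real (card M) > 0" by (simp add: card_gt_0_iff)
        moreover define c where "c = inverse (real (card M))"
        have "0 \<le> c" by (simp add: c_def)
        moreover have "real (card M) * c = 1"
          unfolding c_def using pos by (intro right_inverse) linarith
        moreover have "matching_vertex M /\<^sub>R real (card M) = (\<Sum>p\<in>M. c *\<^sub>R edge_vertex p)"
          by (simp add: matching_vertex_def scaleR_right.sum c_def)
        moreover have "(\<Sum>p\<in>M. c *\<^sub>R edge_vertex p) \<in> convex hull (edge_vertex ` E)"
          using \<open>0 \<le> c\<close> \<open>_ * c = 1\<close> M(1) by (intro convex_sum) (auto intro!: hull_inc)
        ultimately show ?thesis by (simp add: left_sum_matching_vertex)
      qed
      ultimately show "matching_vertex M \<in> ?L" unfolding truncated_cone_def by blast
    qed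
  qed
  show "?L \<subseteq> ?R"
  proof
    fix x assume x: "x \<in> ?L"
    let ?T = "{t :: real^('k \<times> 'm). (\<forall>p. 0 \<le> t $ p) \<and> (\<forall>p. p \<notin> E \<longrightarrow> t $ p = 0)}"
    have "convex ?T"
      unfolding convex_def by auto
    have edge: "edge_vertex p \<in> edge_sum ` ?T" if "p \<in> E" for p
    proof -
      have "edge_vertex p = edge_sum (\<chi> q. if q \<in> {p} then 1 else 0)"
        by (simp only: edge_sum_indicator matching_vertex_def) simp
      then show ?thesis using that by (intro image_eqI) auto
    qed
    have hull: "convex hull (edge_vertex ` E) \<subseteq> edge_sum ` ?T"
      using edge by (intro hull_minimal convex_linear_image linear_edge_sum \<open>convex ?T\<close>) auto
    show "x \<in> ?R"
    proof (cases "x = 0")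
      case True
      then have "x = matching_vertex {}" by (simp add: matching_vertex_def)
      then show ?thesis by (intro hull_inc image_eqI[of _ _ "{}"]) (auto simp: matching_def)
    next
      case False
      note px = truncated_cone_left_sum_pos[OF x False]
      then obtain t where t: "x /\<^sub>R left_sum x = edge_sum t" "t \<in> ?T" using hull by blast
      have "x = edge_sum (left_sum x *\<^sub>R t)"
        using px t(1)[symmetric] by (simp add: linear_cmul[OF linear_edge_sum])
      moreover from this have "left_sum x *\<^sub>R t \<in> fractional_matchings E"
        using t(2) px x by (auto simp: fractional_matchings_def truncated_cone_def)
      ultimately show ?thesis using edge_sum_fractional_matchings by blast
    qed
  qed
qed

lemma cell_eq_hull:
  assumes "polytope F" "vertices F \<subseteq> range edge_vertex"
  shows "F = convex hull (edge_vertex ` {p. edge_vertex p \<in> F})"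
proof
  have "vertices F \<subseteq> edge_vertex ` {p. edge_vertex p \<in> F}"
    using assms(2) vertices_subset[of F] by blast
  then show "F \<subseteq> convex hull (edge_vertex ` {p. edge_vertex p \<in> F})"
    using hull_mono convex_hull_vertices[OF assms(1)] by metis
  show "convex hull (edge_vertex ` {p. edge_vertex p \<in> F}) \<subseteq> F"
    using polytope_imp_convex[OF assms(1)] by (intro hull_minimal) auto
qed

text \<open>Each coordinate of \<open>x\<close> is an end of the unit interval, so the ends of a
  segment with \<open>x\<close> strictly inside agree in every coordinate.\<close>

lemma zero_one_vertex:
  fixes x :: "real^'n"
  assumes "x \<in> S" "\<And>y l. y \<in> S \<Longrightarrow> 0 \<le> y $ l \<and> y $ l \<le> 1" "\<And>l. x $ l \<in> {0, 1}"
  shows "x \<in> vertices S"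
proof -
  have "x \<notin> open_segment a b" if "a \<in> S" "b \<in> S" for a b
  proof
    assume "x \<in> open_segment a b"
    then obtain u where u: "a \<noteq> b" "0 < u" "u < 1" "x = (1 - u) *\<^sub>R a + u *\<^sub>R b"
      by (auto simp: in_segment)
    have "a $ l = b $ l" for l
    proof -
      have xl: "x $ l = (1 - u) * a $ l + u * b $ l" using u by simp
      have ab: "0 \<le> a $ l" "a $ l \<le> 1" "0 \<le> b $ l" "b $ l \<le> 1" using assms(2) that by auto
      consider "x $ l = 0" | "x $ l = 1" using assms(3)[of l] by auto
      then show ?thesis
      proof cases
        case 1
        then have "(1 - u) * a $ l = 0 \<and> u * b $ l = 0"
          using xl ab u by (intro conjI; simp add: add_nonneg_eq_0_iff)
        then show ?thesis using u by simp
      next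
        case 2
        have "(1 - u) * (1 - a $ l) + u * (1 - b $ l) = 0" using 2 xl by (simp add: algebra_simps)
        moreover have "0 \<le> (1 - u) * (1 - a $ l)" "0 \<le> u * (1 - b $ l)" using ab u by simp_all
        ultimately have "(1 - u) * (1 - a $ l) = 0 \<and> u * (1 - b $ l) = 0" by linarith
        then show ?thesis using u by simp
      qed
    qed
    then show False using u by (simp add: vec_eq_iff)
  qed
  then show ?thesis using assms(1) by (auto simp: vertices_def extreme_point_of_def)
qed

lemma vertices_simplex_product: "vertices simplex_product = range edge_vertex"
proof
  show "vertices simplex_product \<subseteq> range edge_vertex"
    unfolding simplex_product_hull by (rule vertices_convex_hull_subset)
  have le1: "0 \<le> x $ l \<and> x $ l \<le> 1" if "x \<in> simplex_product" for x :: "real^('a + 'b)" and l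
    using truncated_cone_Int_simplex_product[OF order_refl] that
    by (auto simp: truncated_cone_def simplex_product_eq)
  have "edge_vertex p \<in> simplex_product" for p
    unfolding simplex_product_hull by (auto intro: hull_inc)
  then show "range edge_vertex \<subseteq> vertices (simplex_product :: (real^('a + 'b)) set)"
    using le1 by (auto intro!: zero_one_vertex simp: edge_vertex_nth split: if_splits)
qed

lemma truncated_cone_simplex_product:
  "truncated_cone simplex_product = {x. left_sum x = right_sum x \<and> (\<forall>l. 0 \<le> x $ l \<and> x $ l \<le> 1)}"
proof -
  have "x \<in> truncated_cone simplex_product \<longleftrightarrow>
    left_sum x = right_sum x \<and> (\<forall>l. 0 \<le> x $ l \<and> x $ l \<le> 1)" for x :: "real^('a + 'b)"
  proof (cases "x = 0")
    case False
    \<comment> \<open>For nonnegative coordinates a zero left sum kills the left block, and balance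
      then kills the right one.\<close>
    have *: "0 < left_sum x" if "\<And>l. 0 \<le> x $ l" "left_sum x = right_sum x"
    proof -
      have "0 \<le> left_sum x" by (simp add: left_sum_def that sum_nonneg)
      moreover have "left_sum x \<noteq> 0"
      proof
        assume 0: "left_sum x = 0"
        then have "(\<Sum>i\<in>UNIV. x $ Inl i) = 0" "(\<Sum>j\<in>UNIV. x $ Inr j) = 0"
          using that(2) by (simp_all add: left_sum_def right_sum_def)
        then have "x $ Inl i = 0" "x $ Inr j = 0" for i j
          using that(1) by (simp_all add: sum_nonneg_eq_0_iff)
        then have "x = 0" by (simp add: vec_eq_iff split_sum_all)
        then show False using False by simp
      qed
      ultimately show ?thesis by simp
    qed
    show ?thesis
    proof
      assume "x \<in> truncated_cone simplex_product"
      then show "left_sum x = right_sum x \<and> (\<forall>l. 0 \<le> x $ l \<and> x $ l \<le> 1)"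
        using False by (auto simp: truncated_cone_def simplex_product_eq zero_le_mult_iff field_simps)
    next
      assume "left_sum x = right_sum x \<and> (\<forall>l. 0 \<le> x $ l \<and> x $ l \<le> 1)"
      then show "x \<in> truncated_cone simplex_product"
        using False * by (auto simp: truncated_cone_def simplex_product_eq field_simps)
    qed
  qed simp
  then show ?thesis by blast
qed

section \<open>The complex of faces of truncated cones\<close>

section \<open>The cone over a subdivision\<close>

text \<open>The cones over cells alone are not closed under taking faces: truncation creates faces
  that avoid the apex.\<close>

definition cone_subdivision ::
    "(real^('k::finite + 'm::finite)) set set \<Rightarrow> (real^('k + 'm)) set set" where
  "cone_subdivision \<Gamma> = {G. \<exists>F\<in>\<Gamma>. G face_of truncated_cone F}"

lemma polytope_truncated_cone:
  assumes "polytope F" "vertices F \<subseteq> range edge_vertex"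
  shows "polytope (truncated_cone F)"
  by (subst cell_eq_hull[OF assms], subst truncated_cone_hull) (intro polytope_convex_hull, simp)

lemma vertices_truncated_cone_zero_one:
  assumes "polytope F" "vertices F \<subseteq> range edge_vertex" "x \<in> vertices (truncated_cone F)"
  shows "x $ l \<in> {0, 1}"
proof -
  have "vertices (truncated_cone F)
      \<subseteq> matching_vertex ` {M. M \<subseteq> {p. edge_vertex p \<in> F} \<and> matching M}"
    by (subst cell_eq_hull[OF assms(1,2)], subst truncated_cone_hull) (rule vertices_convex_hull_subset)
  then obtain M where "matching M" "x = matching_vertex M" using assms(3) by blast
  then show ?thesis using matching_vertex_zero_one by simp
qed

lemma vertices_truncated_cone_simplex_product:
  "vertices (truncated_cone simplex_product) =
    {x \<in> truncated_cone simplex_product. \<forall>l. x $ l \<in> {0, 1}}"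
proof
  show "vertices (truncated_cone simplex_product)
      \<subseteq> {x \<in> truncated_cone simplex_product. \<forall>l. x $ l \<in> {0, 1}}"
    using vertices_truncated_cone_zero_one[OF polytope_simplex_product] vertices_subset
    unfolding vertices_simplex_product by blast
  show "{x \<in> truncated_cone simplex_product. \<forall>l. x $ l \<in> {0, 1}}
      \<subseteq> vertices (truncated_cone simplex_product)"
  proof
    fix x
    assume "x \<in> {x \<in> truncated_cone simplex_product. \<forall>l. x $ l \<in> {0, 1}}"
    then show "x \<in> vertices (truncated_cone simplex_product)"
      by (intro zero_one_vertex) (auto simp: truncated_cone_simplex_product)
  qed
qed

lemma polytope_truncated_cone_simplex_product: "polytope (truncated_cone simplex_product)"
  by (intro polytope_truncated_cone polytope_simplex_product) (simp add: vertices_simplex_product)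

lemma subdivision_simplex_product_cell:
  assumes "subdivision simplex_product \<Gamma>" "F \<in> \<Gamma>"
  shows "F \<subseteq> simplex_product" "polytope F" "vertices F \<subseteq> range edge_vertex"
    "polytope (truncated_cone F)"
  using assms polytope_truncated_cone
  by (auto simp: subdivision_def vertices_simplex_product)

lemma subdivision_cone_subdivision:
  assumes "subdivision simplex_product \<Gamma>"
  shows "subdivision (truncated_cone simplex_product) (cone_subdivision \<Gamma>)"
  unfolding subdivision_def
proof (intro conjI ballI allI impI)
  note cell = subdivision_simplex_product_cell[OF assms]
  have "cone_subdivision \<Gamma> = (\<Union>F\<in>\<Gamma>. {G. G face_of truncated_cone F})"
    by (auto simp: cone_subdivision_def)
  then show "finite (cone_subdivision \<Gamma>)"
    using assms cell(4) finite_polytope_faces by (auto simp: subdivision_def)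
  show "\<Union> (cone_subdivision \<Gamma>) = truncated_cone simplex_product"
  proof -
    have "\<Union> (cone_subdivision \<Gamma>) = (\<Union>F\<in>\<Gamma>. truncated_cone F)"
      using face_of_imp_subset face_of_refl[OF polytope_imp_convex[OF cell(4)]]
      by (fastforce simp: cone_subdivision_def)
    also have "\<dots> = truncated_cone (\<Union> \<Gamma>)"
    proof -
      \<comment> \<open>The cone over the empty set still contains the apex, so the equation would
        fail for empty \<open>\<Gamma>\<close>.\<close>
      have "\<Gamma> \<noteq> {}" using assms simplex_product_nonempty by (auto simp: subdivision_def)
      then show ?thesis by (auto simp: truncated_cone_def)
    qed
    also have "\<Union> \<Gamma> = simplex_product" using assms by (simp add: subdivision_def)
    finally show ?thesis .
  qed
next
  note cell = subdivision_simplex_product_cell[OF assms]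
  fix G assume "G \<in> cone_subdivision \<Gamma>"
  then obtain F where F: "F \<in> \<Gamma>" "G face_of truncated_cone F" by (auto simp: cone_subdivision_def)
  show "polytope G" using F cell(4) face_of_polytope_polytope by blast
  show "vertices G \<subseteq> vertices (truncated_cone simplex_product)"
  proof
    fix x assume "x \<in> vertices G"
    then have x: "x \<in> vertices (truncated_cone F)" using vertices_face_subset[OF F(2)] by blast
    then have "x \<in> truncated_cone simplex_product"
      using vertices_subset truncated_cone_mono[OF cell(1)[OF F(1)]] by blast
    then show "x \<in> vertices (truncated_cone simplex_product)"
      using vertices_truncated_cone_zero_one[OF cell(2,3)[OF F(1)] x]
      by (simp add: vertices_truncated_cone_simplex_product)
  qed
  show "H \<in> cone_subdivision \<Gamma>" if "H face_of G" for H
    using that F face_of_trans by (auto simp: cone_subdivision_def)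
  fix G' assume "G' \<in> cone_subdivision \<Gamma>"
  then obtain F' where F': "F' \<in> \<Gamma>" "G' face_of truncated_cone F'"
    by (auto simp: cone_subdivision_def)
  \<comment> \<open>Coning commutes with intersection, so two truncated cones meet in a common face,
    and this passes to their faces.\<close>
  have "(F \<inter> F') face_of F" "(F \<inter> F') face_of F'"
    using assms F F' by (auto simp: subdivision_def)
  then have "(truncated_cone F \<inter> truncated_cone F') face_of truncated_cone F"
    "(truncated_cone F \<inter> truncated_cone F') face_of truncated_cone F'"
    by (simp_all add: truncated_cone_face flip: truncated_cone_Int)
  then show "(G \<inter> G') face_of G" "(G \<inter> G') face_of G'"
    using face_of_Int_subface F F' by blast+
qed

lemma cone_subdivision_subset:
  assumes "subdivision simplex_product \<Gamma>" "G \<in> cone_subdivision \<Gamma>"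
  shows "G \<subseteq> truncated_cone simplex_product"
  using subdivision_cone_subdivision[OF assms(1)] assms(2) by (auto simp: subdivision_def)

lemma truncated_cone_in_cone_subdivision:
  assumes "subdivision simplex_product \<Gamma>" "F \<in> \<Gamma>"
  shows "truncated_cone F \<in> cone_subdivision \<Gamma>"
  using face_of_refl[OF polytope_imp_convex[OF subdivision_simplex_product_cell(4)[OF assms]]] assms(2)
  by (auto simp: cone_subdivision_def)

lemma cone_subdivision_slice:
  assumes "subdivision simplex_product \<Gamma>" "G \<in> cone_subdivision \<Gamma>"
  shows "G \<inter> simplex_product \<in> \<Gamma>"
proof -
  obtain F where F: "F \<in> \<Gamma>" "G face_of truncated_cone F"
    using assms by (auto simp: cone_subdivision_def)
  have "(G \<inter> simplex_product) face_of (truncated_cone F \<inter> simplex_product)"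
    by (intro face_of_slice F polytope_imp_convex polytope_simplex_product)
  also have "truncated_cone F \<inter> simplex_product = F"
    using subdivision_simplex_product_cell[OF assms(1) F(1)]
    by (intro truncated_cone_Int_simplex_product)
  finally show ?thesis using assms(1) F by (auto simp: subdivision_def)
qed

section \<open>Cells that meet the relative interior\<close>

section \<open>Interior cells\<close>

lemma affine_left_sum_right_sum:
  "affine {x. left_sum x = a \<and> right_sum x = b}" "affine {x. left_sum x = right_sum x}"
  by (auto simp: affine_def simp flip: distrib_right)

lemma mem_rel_frontier_simplex_product:
  fixes x :: "real^('k::finite + 'm::finite)"
  assumes "x \<in> simplex_product"
  shows "x \<in> rel_frontier simplex_product \<longleftrightarrow> \<not> (\<forall>l. 0 < x $ l)"
proof -
  let ?H = "{x::real^('k + 'm). left_sum x = 1 \<and> right_sum x = 1}"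
  have le1: "y $ l \<le> 1" if "y \<in> simplex_product" for y :: "real^('k + 'm)" and l
    using truncated_cone_Int_simplex_product[OF order_refl] that by (auto simp: truncated_cone_def)
  \<comment> \<open>The upper bound 2 is never tight. With bound 1 the open box would miss
    \<open>?H\<close> if \<open>CARD('k)\<close> or \<open>CARD('m)\<close> is 1, as a block then
    consists of the constant coordinate 1.\<close>
  have eq: "simplex_product = cbox 0 (\<chi> l. 2) \<inter> ?H"
  proof (intro equalityI subsetI)
    fix y :: "real^('k + 'm)" assume y: "y \<in> simplex_product"
    have "y $ l \<le> 2" for l using le1[OF y, of l] by simp
    then show "y \<in> cbox 0 (\<chi> l. 2) \<inter> ?H" using y by (simp add: simplex_product_eq mem_box_cart)
  qed (auto simp: simplex_product_eq mem_box_cart)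
  \<comment> \<open>The barycentre witnesses that the open box meets \<open>?H\<close>, which is
    what allows the relative interior to be computed factorwise.\<close>
  define z :: "real^('k + 'm)"
    where "z = (\<chi> l. case l of Inl i \<Rightarrow> 1 / real CARD('k) | Inr j \<Rightarrow> 1 / real CARD('m))"
  have "1 < 2 * real CARD('k)" "1 < 2 * real CARD('m)"
    using zero_less_card_finite[where 'a = 'k] zero_less_card_finite[where 'a = 'm] by linarith+
  then have "z \<in> box 0 (\<chi> l. 2) \<inter> ?H"
    by (auto simp: z_def mem_box_cart left_sum_def right_sum_def field_simps split: sum.splits)
  then have "rel_interior simplex_product = box 0 (\<chi> l. 2) \<inter> ?H"
    unfolding eq using rel_interior_convex_Int_affine[of "cbox 0 (\<chi> l. 2)" ?H]
    by (auto simp: affine_left_sum_right_sum)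
  moreover have "closed (simplex_product :: (real^('k + 'm)) set)"
    by (intro polytope_imp_closed polytope_simplex_product)
  ultimately have "x \<in> rel_frontier simplex_product \<longleftrightarrow> x \<notin> box 0 (\<chi> l. 2) \<inter> ?H"
    using assms by (simp add: rel_frontier_def)
  moreover have "x $ l < 2" for l using le1[OF assms, of l] by simp
  ultimately show ?thesis using assms by (auto simp: mem_box_cart simplex_product_eq)
qed

lemma mem_rel_frontier_truncated_cone:
  fixes x :: "real^('k::finite + 'm::finite)"
  assumes "x \<in> truncated_cone simplex_product"
  shows "x \<in> rel_frontier (truncated_cone simplex_product) \<longleftrightarrow> \<not> (\<forall>l. 0 < x $ l \<and> x $ l < 1)"
proof -
  let ?H = "{x::real^('k + 'm). left_sum x = right_sum x}"
  have eq: "truncated_cone simplex_product = cbox 0 1 \<inter> ?H"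
    by (auto simp: truncated_cone_simplex_product mem_box_cart)
  \<comment> \<open>Half the barycentre of the product: the barycentre itself has a coordinate 1 if
    a block has one element.\<close>
  define z :: "real^('k + 'm)"
    where "z = (\<chi> l. case l of Inl i \<Rightarrow> 1 / (2 * real CARD('k)) | Inr j \<Rightarrow> 1 / (2 * real CARD('m)))"
  have "1 < 2 * real CARD('k)" "1 < 2 * real CARD('m)"
    using zero_less_card_finite[where 'a = 'k] zero_less_card_finite[where 'a = 'm] by linarith+
  then have "z \<in> box 0 1 \<inter> ?H"
    by (auto simp: z_def mem_box_cart left_sum_def right_sum_def field_simps split: sum.splits)
  then have "rel_interior (truncated_cone simplex_product) = box 0 1 \<inter> ?H"
    unfolding eq using rel_interior_convex_Int_affine[of "cbox 0 1" ?H]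
    by (auto simp: affine_left_sum_right_sum)
  moreover have "closed (truncated_cone simplex_product :: (real^('k + 'm)) set)"
    by (intro polytope_imp_closed polytope_truncated_cone_simplex_product)
  ultimately have "x \<in> rel_frontier (truncated_cone simplex_product) \<longleftrightarrow> x \<notin> box 0 1 \<inter> ?H"
    using assms by (simp add: rel_frontier_def)
  then show ?thesis using assms by (auto simp: mem_box_cart truncated_cone_simplex_product)
qed

text \<open>Positive scaling preserves positivity of coordinates, and scaling a point of
  \<open>F\<close> by 1/2 makes all upper bounds strict.\<close>

lemma truncated_cone_interior:
  fixes F :: "(real^('k::finite + 'm::finite)) set"
  assumes "F \<subseteq> simplex_product"
  shows "truncated_cone F \<subseteq> rel_frontier (truncated_cone simplex_product)
    \<longleftrightarrow> F \<subseteq> rel_frontier simplex_product"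
proof -
  have "(\<exists>x\<in>truncated_cone F. \<forall>l. 0 < x $ l \<and> x $ l < 1) \<longleftrightarrow> (\<exists>x\<in>F. \<forall>l. 0 < x $ l)"
  proof
    assume "\<exists>x\<in>truncated_cone F. \<forall>l. 0 < x $ l \<and> x $ l < 1"
    then obtain x where x: "x \<in> truncated_cone F" "\<And>l. 0 < x $ l" by auto
    then have "x \<noteq> 0" by (metis less_irrefl zero_index)
    from truncated_cone_left_sum_pos[OF x(1) this] x(2) show "\<exists>x\<in>F. \<forall>l. 0 < x $ l"
      by (intro bexI[of _ "x /\<^sub>R left_sum x"]) auto
  next
    assume "\<exists>x\<in>F. \<forall>l. 0 < x $ l"
    then obtain x where x: "x \<in> F" "\<And>l. 0 < x $ l" by auto
    have "x \<in> truncated_cone F" using x truncated_cone_Int_simplex_product[OF assms] by blast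
    then have le1: "x $ l \<le> 1" for l by (simp add: truncated_cone_def)
    then have half: "((1/2) *\<^sub>R x) $ l < 1" for l by (simp add: order.strict_trans1[of _ 1])
    have "(1/2) *\<^sub>R x \<in> truncated_cone F"
      using x assms half normalize_scaleR[of "1/2" x]
      by (auto simp: truncated_cone_def simplex_product_eq less_imp_le)
    then show "\<exists>x\<in>truncated_cone F. \<forall>l. 0 < x $ l \<and> x $ l < 1"
      using x half by (intro bexI[of _ "(1/2) *\<^sub>R x"]) auto
  qed
  then show ?thesis
    using mem_rel_frontier_simplex_product mem_rel_frontier_truncated_cone assms
      truncated_cone_mono[OF assms] by (smt (verit) subset_iff)
qed

text \<open>Where no upper bound is tight, the ray from the apex through \<open>x\<close> continues
  beyond \<open>x\<close> inside the truncated cone. So \<open>x\<close> lies strictly between the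
  apex and a further point, and a face through \<open>x\<close> contains both.\<close>

lemma face_of_truncated_cone_apex:
  assumes "G face_of truncated_cone F" "x \<in> G" "x \<noteq> 0" "\<And>l. x $ l < 1"
  shows "0 \<in> G"
proof -
  have x: "x \<in> truncated_cone F" using assms face_of_imp_subset by blast
  obtain e where e: "e > 0" "\<And>l. e * \<bar>x $ l\<bar> \<le> 1 - x $ l"
    using small_scalar[of UNIV "\<lambda>l. 1 - x $ l" "\<lambda>l. x $ l"] assms(4) by auto
  define y where "y = (1 + e) *\<^sub>R x"
  have "y $ l \<le> 1" for l
  proof -
    have "e * x $ l \<le> e * \<bar>x $ l\<bar>" using e(1) by (intro mult_left_mono) auto
    then show ?thesis using e(2)[of l] by (simp add: y_def distrib_right)
  qed
  moreover have "y /\<^sub>R left_sum y = x /\<^sub>R left_sum x"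
    unfolding y_def using e(1) by (intro normalize_scaleR) simp
  moreover have "0 < left_sum y"
    using truncated_cone_left_sum_pos(1)[OF x assms(3)] e(1) by (simp add: y_def)
  ultimately have "y \<in> truncated_cone F"
    using truncated_cone_left_sum_pos(2)[OF x assms(3)] by (simp add: truncated_cone_def)
  moreover have "x = (1 / (1 + e)) *\<^sub>R y" using e by (simp add: y_def)
  then have "x \<in> open_segment 0 y"
    using e(1) assms(3) unfolding in_segment
    by (intro conjI exI[of _ "1 / (1 + e)"]) auto
  ultimately show ?thesis
    using assms(1,2) zero_in_truncated_cone unfolding face_of_def by blast
qed

text \<open>With a nonzero point, a face through the apex contains the whole part of its ray inside
  the truncated cone: convexity gives the part towards the apex, the face property the part beyond.
  So the slice determines the face.\<close>

lemma face_of_truncated_cone_eq: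
  assumes "F \<subseteq> simplex_product" "G face_of truncated_cone F" "0 \<in> G"
  shows "G = truncated_cone (G \<inter> simplex_product)"
proof -
  have face: "a \<in> G \<and> b \<in> G"
    if "a \<in> truncated_cone F" "b \<in> truncated_cone F" "x \<in> G" "x \<in> open_segment a b" for a b x
    using that assms(2) unfolding face_of_def by blast
  have convG: "convex G" using assms face_of_imp_convex by blast
  have scale: "s *\<^sub>R y \<in> G" if "y \<in> G" "0 \<le> s" "s \<le> 1" for s y
    using convexD[OF convG assms(3) that(1), of "1 - s" s] that by simp
  have up: "y \<in> G" if "s *\<^sub>R y \<in> G" "0 < s" "s < 1" "y \<noteq> 0" "y \<in> truncated_cone F" for s y
    using face[of 0 y "s *\<^sub>R y"] that by (auto simp: in_segment)
  have slice: "truncated_cone F \<inter> simplex_product = F"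
    using assms by (intro truncated_cone_Int_simplex_product)
  have GF: "G \<subseteq> truncated_cone F" using assms face_of_imp_subset by blast
  show ?thesis
  proof
    show "G \<subseteq> truncated_cone (G \<inter> simplex_product)"
    proof
      fix y assume y: "y \<in> G"
      show "y \<in> truncated_cone (G \<inter> simplex_product)"
      proof (cases "y = 0")
        case False
        have yF: "y \<in> truncated_cone F" using y GF by blast
        note py = truncated_cone_left_sum_pos[OF yF False]
        define f where "f = y /\<^sub>R left_sum y"
        have f: "f \<in> F" "y = left_sum y *\<^sub>R f" "f \<noteq> 0" using py False by (auto simp: f_def)
        have "f \<in> G"
        \<comment> \<open>The slice point \<open>f\<close> lies beyond \<open>y\<close> if
          \<open>left_sum y < 1\<close>, and otherwise on the segment from the apex to
          \<open>y\<close>.\<close>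
        proof (cases "left_sum y < 1")
          case True
          then show ?thesis using up[of "left_sum y" f] f y py slice by auto
        next
          case False
          then show ?thesis unfolding f_def using y py by (intro scale) (auto simp: field_simps)
        qed
        then show ?thesis using py yF f assms(1) unfolding truncated_cone_def f_def by auto
      qed simp
    qed
    show "truncated_cone (G \<inter> simplex_product) \<subseteq> G"
    proof
      fix y assume y: "y \<in> truncated_cone (G \<inter> simplex_product)"
      have "G \<inter> simplex_product \<subseteq> F" using GF slice by blast
      then have yF: "y \<in> truncated_cone F" using y truncated_cone_mono by blast
      show "y \<in> G"
      proof (cases "y = 0")
        case False
        note py = truncated_cone_left_sum_pos[OF y False]
        show ?thesis
        proof (cases "left_sum y \<le> 1")
          case True
          then have "left_sum y *\<^sub>R (y /\<^sub>R left_sum y) \<in> G"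
            using py by (intro scale[of "y /\<^sub>R left_sum y"]) auto
          then show ?thesis using py by simp
        next
          case False
          then show ?thesis
            using up[of "inverse (left_sum y)" y] py yF \<open>y \<noteq> 0\<close> by (auto simp: field_simps)
        qed
      qed (use assms in simp)
    qed
  qed
qed

lemma interior_cells_cone_subdivision:
  assumes "subdivision simplex_product \<Gamma>"
  shows "interior_cells (truncated_cone simplex_product) (cone_subdivision \<Gamma>)
    = truncated_cone ` interior_cells simplex_product \<Gamma>"
proof
  note cell = subdivision_simplex_product_cell[OF assms]
  show "truncated_cone ` interior_cells simplex_product \<Gamma>
      \<subseteq> interior_cells (truncated_cone simplex_product) (cone_subdivision \<Gamma>)"
    using truncated_cone_in_cone_subdivision[OF assms] truncated_cone_interior[OF cell(1)]
    by (auto simp: interior_cells_def)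
  show "interior_cells (truncated_cone simplex_product) (cone_subdivision \<Gamma>)
      \<subseteq> truncated_cone ` interior_cells simplex_product \<Gamma>"
  proof
    fix G assume "G \<in> interior_cells (truncated_cone simplex_product) (cone_subdivision \<Gamma>)"
    then have G: "G \<in> cone_subdivision \<Gamma>" "\<not> G \<subseteq> rel_frontier (truncated_cone simplex_product)"
      by (auto simp: interior_cells_def)
    then obtain F where F: "F \<in> \<Gamma>" "G face_of truncated_cone F"
      by (auto simp: cone_subdivision_def)
    obtain x where x: "x \<in> G" "\<And>l. 0 < x $ l" "\<And>l. x $ l < 1"
      using G(2) cone_subdivision_subset[OF assms G(1)] mem_rel_frontier_truncated_cone by blast
    have "x \<noteq> 0" using x(2) by (metis less_irrefl zero_index)
    then have "0 \<in> G" using face_of_truncated_cone_apex F x by blast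
    then have eq: "G = truncated_cone (G \<inter> simplex_product)"
      using face_of_truncated_cone_eq[OF cell(1)[OF F(1)] F(2)] by blast
    moreover have "G \<inter> simplex_product \<in> interior_cells simplex_product \<Gamma>"
      using cone_subdivision_slice[OF assms G(1)] G(2)
        truncated_cone_interior[of "G \<inter> simplex_product"] eq
      by (auto simp: interior_cells_def)
    ultimately show "G \<in> truncated_cone ` interior_cells simplex_product \<Gamma>" by blast
  qed
qed

section \<open>The involution \<open>iota\<close> and the vertices of the hypersimplex\<close>

section \<open>The hypersimplex as a truncated cone\<close>

definition flip_left :: "real^('k::finite + 'm::finite) \<Rightarrow> real^('k + 'm)" where
  "flip_left x = (\<chi> l. case l of Inl i \<Rightarrow> - x $ Inl i | Inr j \<Rightarrow> x $ Inr j)"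

lemma iota_eq: "iota = (\<lambda>x. e_vec initial_block + flip_left x)"
  by (auto simp: fun_eq_iff vec_eq_iff iota_def flip_left_def e_vec_nth split: sum.splits)

lemma iota_nth [simp]: "iota x $ Inl i = 1 - x $ Inl i" "iota x $ Inr j = x $ Inr j"
  by (simp_all add: iota_def)

lemma iota_iota [simp]: "iota (iota x) = x"
  by (simp add: vec_eq_iff split_sum_all)

lemma image_iota_iota [simp]: "iota ` iota ` S = S"
  by (simp add: image_image)

lemma inj_iota: "inj iota"
  by (metis injI iota_iota)

lemma orthogonal_flip_left: "orthogonal_transformation flip_left"
  unfolding orthogonal_transformation_def
proof (intro conjI allI)
  show "linear flip_left"
    by (rule linearI) (simp_all add: flip_left_def vec_eq_iff split_sum_all)
  show "flip_left x \<bullet> flip_left y = x \<bullet> y" for x y :: "real^('a + 'b)"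
    unfolding inner_vec_def by (intro sum.cong) (auto simp: flip_left_def split: sum.splits)
qed

lemma linear_flip_left: "linear flip_left" and inj_flip_left: "inj flip_left"
  by (rule orthogonal_transformation_linear orthogonal_transformation_inj, rule orthogonal_flip_left)+

lemma induced_subdivision_iota:
  "(`) iota ` induced_subdivision P (\<lambda>x. h (iota x)) \<subseteq> induced_subdivision (iota ` P) h"
  unfolding iota_eq by (rule induced_subdivision_affine_image[OF orthogonal_flip_left])

lemma sum_UNIV_sum:
  "(\<Sum>l\<in>UNIV. f l) = (\<Sum>i\<in>UNIV. f (Inl i)) + (\<Sum>j\<in>UNIV. f (Inr j))"
  for f :: "'k::finite + 'm::finite \<Rightarrow> 'a::comm_monoid_add"
  unfolding UNIV_Plus_UNIV[symmetric] by (subst sum.Plus) (simp_all add: comp_def)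

text \<open>Hence coordinate sum \<open>CARD('k)\<close> becomes the balance
  \<open>left_sum x = right_sum x\<close>, and the second equation of
  \<open>perp_initial_block\<close> becomes \<open>left_sum x = 1\<close>.\<close>

lemma sum_iota:
  fixes x :: "real^('k::finite + 'm::finite)"
  shows "(\<Sum>l\<in>UNIV. iota x $ l) = real CARD('k) - left_sum x + right_sum x"
    and "(\<Sum>l\<in>initial_block. iota x $ l) = real CARD('k) - left_sum x"
  by (simp_all add: sum_UNIV_sum sum.reindex sum_subtractf left_sum_def right_sum_def)

lemma sum_e_vec: "(\<Sum>l\<in>UNIV. e_vec \<sigma> $ l) = real (card \<sigma>)"
  by (simp add: e_vec_nth sum.If_cases)

lemma iota_vertex:
  fixes x :: "real^('k::finite + 'm::finite)"
  assumes "x \<in> vertices (truncated_cone simplex_product)"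
  shows "iota x = e_vec {l. iota x $ l = 1}" "card {l. iota x $ l = 1} = CARD('k)"
proof -
  have x: "left_sum x = right_sum x" "\<And>l. x $ l \<in> {0, 1}"
    using assms unfolding vertices_truncated_cone_simplex_product
    by (simp_all add: truncated_cone_simplex_product)
  have "iota x $ l \<in> {0, 1}" for l using x(2)[of l] by (cases l) auto
  then show eq: "iota x = e_vec {l. iota x $ l = 1}" by (auto simp: vec_eq_iff e_vec_nth)
  have "real (card {l. iota x $ l = 1}) = real CARD('k)"
    using sum_iota(1)[of x] x(1) sum_e_vec[of "{l. iota x $ l = 1}"] eq by simp
  then show "card {l. iota x $ l = 1} = CARD('k)" by simp
qed

lemma iota_vertices:
  "iota ` vertices (truncated_cone simplex_product) =
    e_vec ` {\<sigma> :: ('k::finite + 'm::finite) set. card \<sigma> = CARD('k)}"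
proof
  show "iota ` vertices (truncated_cone simplex_product)
      \<subseteq> e_vec ` {\<sigma> :: ('k + 'm) set. card \<sigma> = CARD('k)}"
    using iota_vertex by blast
  show "e_vec ` {\<sigma> :: ('k + 'm) set. card \<sigma> = CARD('k)}
      \<subseteq> iota ` vertices (truncated_cone simplex_product)"
  proof clarify
    fix \<sigma> :: "('k + 'm) set" assume \<sigma>: "card \<sigma> = CARD('k)"
    define x where "x = iota (e_vec \<sigma>)"
    have "left_sum x = right_sum x"
      using sum_iota(1)[of x] sum_e_vec[of \<sigma>] \<sigma> by (simp add: x_def)
    moreover have zero_one: "x $ l \<in> {0, 1}" for l by (cases l) (auto simp: x_def e_vec_nth)
    have "0 \<le> x $ l \<and> x $ l \<le> 1" for l using zero_one[of l] by auto
    ultimately have "x \<in> truncated_cone simplex_product"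
      by (simp add: truncated_cone_simplex_product)
    then have "x \<in> vertices (truncated_cone simplex_product)"
      using zero_one by (simp add: vertices_truncated_cone_simplex_product)
    then show "e_vec \<sigma> \<in> iota ` vertices (truncated_cone simplex_product)"
      by (intro image_eqI[of _ _ x]) (simp_all add: x_def)
  qed
qed

lemma hypersimplex_eq:
  "hypersimplex CARD('k) = iota ` (truncated_cone simplex_product :: (real^('k::finite + 'm::finite)) set)"
proof -
  let ?Q = "truncated_cone simplex_product :: (real^('k + 'm)) set"
  have "iota ` ?Q = iota ` (convex hull vertices ?Q)"
    by (simp add: convex_hull_vertices[OF polytope_truncated_cone_simplex_product])
  also have "\<dots> = convex hull (iota ` vertices ?Q)"
    unfolding iota_eq by (rule convex_hull_affine_image[OF linear_flip_left, symmetric])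
  also have "\<dots> = hypersimplex CARD('k)" by (simp add: iota_vertices hypersimplex_def)
  finally show ?thesis by simp
qed

lemma iota_Int_perp:
  fixes G :: "(real^('k::finite + 'm::finite)) set"
  assumes "G \<subseteq> truncated_cone simplex_product"
  shows "iota ` G \<inter> perp_initial_block = iota ` (G \<inter> simplex_product)"
proof -
  have "iota x \<in> perp_initial_block \<longleftrightarrow> x \<in> simplex_product" if "x \<in> G" for x
  proof -
    have "left_sum x = right_sum x" "\<And>l. 0 \<le> x $ l"
      using assms that by (auto simp: truncated_cone_simplex_product)
    then show ?thesis
      unfolding perp_initial_block_def mem_Collect_eq sum_iota by (auto simp: simplex_product_eq)
  qed
  then show ?thesis by auto
qed

section \<open>Tropical determinants as minimal weights of matchings\<close>

section \<open>Heights\<close>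

lemma V_bar_nth [simp]:
  "V_bar V $ i $ Inl i' = (if i = i' then 0 else \<infinity>)" "V_bar V $ i $ Inr j = ereal (V $ i $ j)"
  by (simp_all add: V_bar_def tropical_id_def)

lemma matching_vertex_in_vertices:
  assumes "matching M"
  shows "matching_vertex M \<in> vertices (truncated_cone simplex_product)"
proof -
  have "matching_vertex M \<in> truncated_cone simplex_product"
    unfolding simplex_product_hull truncated_cone_hull using assms by (intro hull_inc) auto
  then show ?thesis
    using matching_vertex_zero_one[OF assms] by (simp add: vertices_truncated_cone_simplex_product)
qed

lemma matching_vertex_eq_1_iff:
  assumes "matching M"
  shows "matching_vertex M $ Inl i = 1 \<longleftrightarrow> i \<in> fst ` M"
    and "matching_vertex M $ Inr j = 1 \<longleftrightarrow> j \<in> snd ` M"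
proof -
  have "real (card A) = 1 \<longleftrightarrow> A \<noteq> {}" if "real (card A) \<in> {0, 1}" for A :: "('a \<times> 'b) set"
    using that by (cases "A = {}") auto
  then have "matching_vertex M $ l = 1 \<longleftrightarrow> {p\<in>M. l \<in> edge_ends p} \<noteq> {}" for l
    using matching_vertex_zero_one[OF assms, of l] unfolding matching_vertex_nth by blast
  then show "matching_vertex M $ Inl i = 1 \<longleftrightarrow> i \<in> fst ` M"
    and "matching_vertex M $ Inr j = 1 \<longleftrightarrow> j \<in> snd ` M"
    by (simp_all add: edge_ends_def image_def) force+
qed

text \<open>\<open>M\<close> yields one of the bijections in the minimum: matched rows take the
  column of their partner, the other rows their own column of the identity block at cost 0.\<close>

lemma tau_height_le:
  assumes "matching M"
  shows "tau_height V (iota (matching_vertex M)) \<le> (\<Sum>p\<in>M. V $ fst p $ snd p)"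
proof -
  define x where "x = matching_vertex M"
  define \<sigma> where "\<sigma> = {l. iota x $ l = 1}"
  have card: "card \<sigma> = CARD('a)"
    using iota_vertex(2)[OF matching_vertex_in_vertices[OF assms]] by (simp add: x_def \<sigma>_def)
  have inj: "inj_on fst M" "inj_on snd M" using assms by (auto simp: matching_def)
  define j where "j i = snd (the_inv_into M fst i)" for i
  have j: "j (fst p) = snd p" if "p \<in> M" for p
    using the_inv_into_f_f[OF inj(1) that] by (simp add: j_def)
  define \<omega> where "\<omega> i = (if i \<in> fst ` M then Inr (j i) else Inl i)" for i
  have "Inl i \<in> \<sigma> \<longleftrightarrow> i \<notin> fst ` M" for i
    using matching_vertex_zero_one[OF assms, of "Inl i"] matching_vertex_eq_1_iff(1)[OF assms, of i]
    by (auto simp: \<sigma>_def x_def)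
  moreover have "Inr b \<in> \<sigma> \<longleftrightarrow> b \<in> snd ` M" for b
    using matching_vertex_eq_1_iff(2)[OF assms] by (simp add: \<sigma>_def x_def)
  ultimately have \<sigma>: "\<sigma> = Inl ` (- fst ` M) \<union> Inr ` snd ` M"
    by (auto simp: set_eq_iff split_sum_all)
  have "inj \<omega>"
  proof (rule injI)
    fix a b assume ab: "\<omega> a = \<omega> b"
    show "a = b"
    proof (cases "a \<in> fst ` M \<and> b \<in> fst ` M")
      case True
      then obtain p q where "p \<in> M" "q \<in> M" "a = fst p" "b = fst q" by auto
      moreover from this have "snd p = snd q" using ab j by (simp add: \<omega>_def)
      ultimately show ?thesis using inj(2) by (auto simp: inj_on_def)
    qed (use ab in \<open>auto simp: \<omega>_def split: if_splits\<close>)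
  qed
  moreover have "range \<omega> = \<sigma>"
  proof -
    have "\<omega> ` (fst ` M) = Inr ` snd ` M" using j by (force simp: \<omega>_def image_image)
    moreover have "\<omega> ` (- fst ` M) = Inl ` (- fst ` M)" by (auto simp: \<omega>_def)
    ultimately show ?thesis unfolding \<sigma> by (metis Compl_partition image_Un sup_commute)
  qed
  ultimately have "bij_betw \<omega> UNIV \<sigma>" by (simp add: bij_betw_def)
  then have "tau V \<sigma> \<le> (\<Sum>i\<in>UNIV. V_bar V $ i $ \<omega> i)"
    unfolding tau_def tdet_def by (intro Min_le) auto
  also have "\<dots> = (\<Sum>i\<in>UNIV. ereal (if i \<in> fst ` M then V $ i $ j i else 0))"
    by (intro sum.cong) (auto simp: \<omega>_def)
  also have "\<dots> = ereal (\<Sum>i\<in>fst ` M. V $ i $ j i)" by (simp add: sum.If_cases)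
  also have "(\<Sum>i\<in>fst ` M. V $ i $ j i) = (\<Sum>p\<in>M. V $ fst p $ snd p)"
    using j by (simp add: sum.reindex[OF inj(1)])
  finally have "tau V \<sigma> \<le> ereal (\<Sum>p\<in>M. V $ fst p $ snd p)" .
  then have "ereal (tau_height V (iota x)) \<le> ereal (\<Sum>p\<in>M. V $ fst p $ snd p)"
    using tau_finite[OF card, of V] by (simp add: tau_height_def \<sigma>_def ereal_real)
  then show ?thesis by (simp add: x_def)
qed

text \<open>An optimal bijection has finite weight and so avoids the infinite entries: a row sent
  into the left block goes to its own column at cost 0, and the other rows form a matching of the
  same weight.\<close>

lemma tau_height_attained:
  fixes x :: "real^('k::finite + 'm::finite)"
  assumes x: "x \<in> vertices (truncated_cone simplex_product)"
  obtains M where "matching M" "matching_vertex M = x"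
    "tau_height V (iota x) = (\<Sum>p\<in>M. V $ fst p $ snd p)"
proof -
  define \<sigma> where "\<sigma> = {l. iota x $ l = 1}"
  have card: "card \<sigma> = CARD('k)" using iota_vertex(2)[OF x] by (simp add: \<sigma>_def)
  let ?S = "{\<Sum>i\<in>UNIV. V_bar V $ i $ \<omega> i | \<omega>. bij_betw \<omega> (UNIV :: 'k set) \<sigma>}"
  have "\<exists>\<omega>. bij_betw \<omega> (UNIV :: 'k set) \<sigma>"
    using card by (intro finite_same_card_bij) auto
  then have "tau V \<sigma> \<in> ?S" unfolding tau_def tdet_def by (intro Min_in) auto
  then obtain \<omega> where \<omega>: "bij_betw \<omega> UNIV \<sigma>" "tau V \<sigma> = (\<Sum>i\<in>UNIV. V_bar V $ i $ \<omega> i)"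
    by auto
  have "(\<Sum>i\<in>UNIV. V_bar V $ i $ \<omega> i) \<noteq> \<infinity>" using tau_finite[OF card, of V] \<omega>(2) by auto
  then have fin: "V_bar V $ i $ \<omega> i \<noteq> \<infinity>" for i by (simp add: sum_Pinfty)
  have diag: "\<omega> i = Inl a \<Longrightarrow> a = i" for i a using fin[of i] by (auto split: if_splits)
  have inj: "\<omega> a = \<omega> b \<Longrightarrow> a = b" for a b using \<omega>(1) by (auto simp: bij_betw_def inj_on_def)
  have range: "l \<in> \<sigma> \<longleftrightarrow> (\<exists>i. \<omega> i = l)" for l using \<omega>(1) by (auto simp: bij_betw_def)
  define M where "M = {p. \<omega> (fst p) = Inr (snd p)}"
  have M: "matching M"
    unfolding matching_def inj_on_def M_def using inj by (auto simp: prod_eq_iff)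
  have zero_one: "x $ l \<in> {0, 1}" for l
    using x by (simp add: vertices_truncated_cone_simplex_product)
  have eq: "matching_vertex M = x"
  proof -
    have "matching_vertex M $ l = 1 \<longleftrightarrow> x $ l = 1" for l
    proof (cases l)
      case (Inl i)
      have "i \<in> fst ` M \<longleftrightarrow> (\<exists>j. \<omega> i = Inr j)" by (auto simp: M_def image_iff)
      also have "\<dots> \<longleftrightarrow> \<omega> i \<noteq> Inl i" using diag[of i] by (cases "\<omega> i") auto
      also have "\<dots> \<longleftrightarrow> Inl i \<notin> \<sigma>" unfolding range using diag by metis
      also have "\<dots> \<longleftrightarrow> x $ Inl i = 1" using zero_one[of "Inl i"] by (auto simp: \<sigma>_def)
      finally show ?thesis using matching_vertex_eq_1_iff(1)[OF M, of i] Inl by simp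
    next
      case (Inr j)
      have "j \<in> snd ` M \<longleftrightarrow> Inr j \<in> \<sigma>" unfolding range by (auto simp: M_def image_iff)
      then show ?thesis using matching_vertex_eq_1_iff(2)[OF M, of j] Inr by (simp add: \<sigma>_def)
    qed
    then have "matching_vertex M $ l = x $ l" for l
      using zero_one[of l] matching_vertex_zero_one[OF M, of l] by (metis insertE singletonD)
    then show ?thesis by (simp add: vec_eq_iff)
  qed
  define v where "v i = (case \<omega> i of Inl a \<Rightarrow> 0 | Inr j \<Rightarrow> V $ i $ j)" for i
  have "V_bar V $ i $ \<omega> i = ereal (v i)" for i
    using diag[of i] by (cases "\<omega> i") (auto simp: v_def)
  then have "tau V \<sigma> = ereal (\<Sum>i\<in>UNIV. v i)" using \<omega>(2) by simp
  also have "(\<Sum>i\<in>UNIV. v i) = (\<Sum>i\<in>fst ` M. v i)"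
    by (rule sum.mono_neutral_right) (auto simp: v_def M_def image_iff split: sum.splits)
  also have "\<dots> = (\<Sum>p\<in>M. v (fst p))" using M by (simp add: sum.reindex matching_def)
  also have "\<dots> = (\<Sum>p\<in>M. V $ fst p $ snd p)" by (intro sum.cong) (auto simp: M_def v_def)
  finally have "tau_height V (iota x) = (\<Sum>p\<in>M. V $ fst p $ snd p)"
    by (simp add: tau_height_def \<sigma>_def)
  then show thesis using that M eq by blast
qed

lemma lifting_height_edge_vertex: "lifting_height V (edge_vertex p) = V $ fst p $ snd p"
  by (simp add: edge_vertex_def lifting_height_prod_vertex)

text \<open>
  The functional supporting the lift of \<open>F\<close> is normalised by a multiple of \<open>left_sum\<close> so that it
  vanishes there; by homogeneity it then supports the lift of the whole cone.
\<close>

lemma truncated_cone_induced: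
  fixes V :: "real^'m::finite^'k::finite"
  assumes F: "F \<in> induced_subdivision simplex_product (lifting_height V)"
    and "polytope F" "vertices F \<subseteq> range edge_vertex"
  shows "truncated_cone F \<in>
    induced_subdivision (truncated_cone simplex_product) (\<lambda>x. tau_height V (iota x))"
proof -
  let ?P = "simplex_product :: (real^('k + 'm)) set"
  let ?L = "lifted_polytope ?P (lifting_height V)"
  define Q where "Q = (truncated_cone simplex_product :: (real^('k + 'm)) set)"
  define h where "h x = tau_height V (iota x)" for x :: "real^('k + 'm)"
  obtain c b where cb: "?L \<subseteq> {z. (c, 1) \<bullet> z \<ge> b}" and FL: "F = fst ` (?L \<inter> {z. (c, 1) \<bullet> z = b})"
    using F by (auto simp: induced_subdivision_def lower_face_of_def)
  define w :: "real^('k + 'm)" where "w = (\<Sum>i\<in>UNIV. axis (Inl i) 1)"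
  have w: "w \<bullet> x = left_sum x" for x
    by (simp add: w_def inner_sum_left inner_axis' left_sum_def)
  define c' where "c' = c - b *\<^sub>R w"
  \<comment> \<open>\<open>f p\<close> is the slack of the edge \<open>p\<close> in the inequality
    that supports the lift of \<open>F\<close>.\<close>
  define f where "f p = V $ fst p $ snd p + c' \<bullet> edge_vertex p" for p
  have f: "f p = V $ fst p $ snd p + c \<bullet> edge_vertex p - b" for p
    by (simp add: f_def c'_def inner_diff_left w)
  have edge_lift: "(edge_vertex p, V $ fst p $ snd p) \<in> ?L" for p
    unfolding lifted_polytope_def
    by (intro hull_inc image_eqI[of _ _ "edge_vertex p"])
      (auto simp: lifting_height_edge_vertex vertices_simplex_product)
  have f_nonneg: "0 \<le> f p" for p
    using cb edge_lift[of p] by (auto simp: f algebra_simps)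
  have f_zero: "f p = 0 \<longleftrightarrow> edge_vertex p \<in> F" for p
  proof
    assume "f p = 0"
    then show "edge_vertex p \<in> F"
      unfolding FL using edge_lift[of p]
      by (intro image_eqI[of _ _ "(edge_vertex p, V $ fst p $ snd p)"]) (auto simp: f)
  next
    assume "edge_vertex p \<in> F"
    then obtain s where s: "(edge_vertex p, s) \<in> ?L" "(c, 1) \<bullet> (edge_vertex p, s) = b"
      unfolding FL by auto
    have "s = V $ fst p $ snd p"
      using lifted_polytope_over_vertex[OF polytope_simplex_product _ s(1)]
      by (simp add: vertices_simplex_product lifting_height_edge_vertex)
    then show "f p = 0" using s(2) by (simp add: f)
  qed
  \<comment> \<open>After the normalisation no constant term remains, so slacks add up along a
    matching.\<close>
  have sum_f: "(c', 1) \<bullet> (matching_vertex M, \<Sum>p\<in>M. V $ fst p $ snd p) = (\<Sum>p\<in>M. f p)" for M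
    by (simp add: f_def matching_vertex_def inner_sum_right sum.distrib)
  have polyQ: "polytope Q" unfolding Q_def by (rule polytope_truncated_cone_simplex_product)
  let ?K = "lifted_polytope Q h"
  let ?X = "(\<lambda>x. (x, h x)) ` vertices Q"
  have K_nonneg: "?K \<subseteq> {z. (c', 1) \<bullet> z \<ge> 0}"
    unfolding lifted_polytope_def
  proof (rule hull_minimal)
    show "?X \<subseteq> {z. (c', 1) \<bullet> z \<ge> 0}"
    proof clarify
      fix x assume x: "x \<in> vertices Q"
      obtain M where "matching_vertex M = x" "h x = (\<Sum>p\<in>M. V $ fst p $ snd p)"
        using tau_height_attained[OF x[unfolded Q_def], of V] unfolding h_def by blast
      then show "0 \<le> (c', 1) \<bullet> (x, h x)"
        using sum_f[of M] f_nonneg by (simp add: sum_nonneg)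
    qed
  qed (rule convex_halfspace_ge)
  let ?T = "?K \<inter> {z. (c', 1) \<bullet> z = 0}"
  have lower: "lower_face_of ?T ?K" using K_nonneg by (auto simp: lower_face_of_def)
  have faceT: "?T face_of ?K" using lower by (rule lower_face_imp_face)
  have hullF: "truncated_cone F =
      convex hull (matching_vertex ` {M. M \<subseteq> {p. edge_vertex p \<in> F} \<and> matching M})"
    by (subst cell_eq_hull[OF assms(2,3)]) (rule truncated_cone_hull)
  have "truncated_cone F = fst ` ?T"
  proof
    have "matching_vertex M \<in> fst ` ?T" if M: "M \<subseteq> {p. edge_vertex p \<in> F}" "matching M" for M
    proof -
      \<comment> \<open>It is not known yet that \<open>M\<close> is optimal. Its total slack 0
        bounds the value at the lifted vertex from above, and \<open>K_nonneg\<close> bounds it from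
        below.\<close>
      have "h (matching_vertex M) \<le> (\<Sum>p\<in>M. V $ fst p $ snd p)"
        unfolding h_def by (rule tau_height_le[OF M(2)])
      moreover have "(c', 1) \<bullet> (matching_vertex M, \<Sum>p\<in>M. V $ fst p $ snd p) = 0"
        unfolding sum_f using M(1) f_zero by (intro sum.neutral) auto
      ultimately have "(c', 1) \<bullet> (matching_vertex M, h (matching_vertex M)) \<le> 0" by simp
      moreover have "(matching_vertex M, h (matching_vertex M)) \<in> ?K"
        unfolding lifted_polytope_def Q_def using matching_vertex_in_vertices[OF M(2)]
        by (intro hull_inc) auto
      ultimately show ?thesis
        using K_nonneg by (intro image_eqI[of _ _ "(matching_vertex M, h (matching_vertex M))"]) force+
    qed
    moreover have "convex (fst ` ?T)"
      by (intro convex_linear_image linear_fst face_of_imp_convex[OF faceT])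
    ultimately show "truncated_cone F \<subseteq> fst ` ?T"
      unfolding hullF by (intro hull_minimal) auto
    obtain X' where X': "X' \<subseteq> ?X" "?T = convex hull X'"
      using face_of_convex_hull_subset[of ?X ?T] faceT finite_vertices[OF polyQ]
      by (auto simp: lifted_polytope_def finite_imp_compact)
    have "fst ` X' \<subseteq> truncated_cone F"
    proof
      fix x assume "x \<in> fst ` X'"
      then have x: "x \<in> vertices Q" "(x, h x) \<in> X'" using X'(1) by auto
      then have "(x, h x) \<in> ?T" unfolding X'(2) by (intro hull_inc)
      then have 0: "(c', 1) \<bullet> (x, h x) = 0" by simp
      obtain M where M: "matching M" "matching_vertex M = x" "h x = (\<Sum>p\<in>M. V $ fst p $ snd p)"
        using tau_height_attained[OF x(1)[unfolded Q_def], of V] unfolding h_def by blast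
      \<comment> \<open>An optimal \<open>M\<close> has total slack 0; as no slack is negative, all
        edges of \<open>M\<close> lie in \<open>F\<close>.\<close>
      have "(\<Sum>p\<in>M. f p) = 0" using sum_f[of M] M 0 by simp
      then have "M \<subseteq> {p. edge_vertex p \<in> F}"
        using f_nonneg f_zero by (auto simp: sum_nonneg_eq_0_iff)
      then show "x \<in> truncated_cone F" unfolding hullF using M by (intro hull_inc) auto
    qed
    moreover have "convex (truncated_cone F)"
      by (intro convex_truncated_cone polytope_imp_convex assms)
    ultimately show "fst ` ?T \<subseteq> truncated_cone F"
      unfolding X'(2) convex_hull_linear_image[OF linear_fst] by (intro hull_minimal)
  qed
  then show ?thesis
    using lower unfolding Q_def h_def induced_subdivision_def by blast
qed

lemma cone_subdivision_induced:
  assumes "subdivision simplex_product \<Gamma>"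
    and "\<Gamma> = induced_subdivision simplex_product (lifting_height V)"
  shows "cone_subdivision \<Gamma> \<subseteq>
    induced_subdivision (truncated_cone simplex_product) (\<lambda>x. tau_height V (iota x))"
proof
  fix G assume "G \<in> cone_subdivision \<Gamma>"
  then obtain F where F: "F \<in> \<Gamma>" "G face_of truncated_cone F" by (auto simp: cone_subdivision_def)
  have "truncated_cone F \<in>
      induced_subdivision (truncated_cone simplex_product) (\<lambda>x. tau_height V (iota x))"
    using F(1) subdivision_simplex_product_cell[OF assms(1) F(1)]
    by (intro truncated_cone_induced) (simp_all flip: assms(2))
  then show "G \<in> induced_subdivision (truncated_cone simplex_product) (\<lambda>x. tau_height V (iota x))"
    using induced_subdivision_face[OF polytope_truncated_cone_simplex_product] F(2) by blast
qed

text \<open>The height \<open>h\<close> is reused unchanged on the product, whose vertices are 0/1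
  points of the truncated cone and hence vertices of it.\<close>

lemma cone_subdivision_regular_imp:
  assumes "subdivision simplex_product \<Gamma>"
    and "cone_subdivision \<Gamma> \<subseteq> induced_subdivision (truncated_cone simplex_product) h"
  shows "regular_subdivision simplex_product \<Gamma>"
proof -
  note cell = subdivision_simplex_product_cell[OF assms(1)]
  have "simplex_product \<subseteq> truncated_cone simplex_product"
    using truncated_cone_Int_simplex_product[OF order_refl] by blast
  then have vert: "vertices simplex_product \<subseteq> vertices (truncated_cone simplex_product)"
    using vertices_subset[of simplex_product]
    by (auto simp: vertices_truncated_cone_simplex_product vertices_simplex_product edge_vertex_nth)
  have "\<Gamma> \<subseteq> induced_subdivision simplex_product h"
  proof
    fix F assume F: "F \<in> \<Gamma>"
    have eq: "truncated_cone F \<inter> simplex_product = F"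
      using cell(1)[OF F] by (rule truncated_cone_Int_simplex_product)
    have "truncated_cone F \<in> induced_subdivision (truncated_cone simplex_product) h"
      using truncated_cone_in_cone_subdivision[OF assms(1) F] assms(2) by blast
    then have "truncated_cone F \<inter> simplex_product \<in> induced_subdivision simplex_product h"
      using polytope_simplex_product polytope_truncated_cone_simplex_product vert cell[OF F]
      by (intro induced_subdivision_Int) (simp_all add: eq vertices_simplex_product)
    then show "F \<in> induced_subdivision simplex_product h" by (simp add: eq)
  qed
  then have "\<Gamma> = induced_subdivision simplex_product h"
    using subdivision_subset_induced_imp_eq polytope_simplex_product simplex_product_nonempty assms(1)
    by blast
  then show ?thesis using assms(1) by (auto simp: regular_subdivision_def)
qed

theorem theorem2p7:
  fixes n k :: nat
    and \<Gamma> :: "(real^('k::finite + 'm::finite)) set set"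
  assumes "0 < k" and "k < n"
    and "CARD('k) = k" and "CARD('m) = n - k"
    and "subdivision simplex_product \<Gamma>"
  shows "\<exists>\<Sigma> :: (real^('k + 'm)) set set.
      subdivision (hypersimplex k) \<Sigma> \<and>
      {C \<inter> perp_initial_block | C. C \<in> \<Sigma>} = {iota ` F | F. F \<in> \<Gamma>} \<and>
      (\<forall>C \<in> maximal_cells \<Sigma>. e_vec initial_block \<in> C) \<and>
      poset_isomorphic (tight_span simplex_product \<Gamma>) (tight_span (hypersimplex k) \<Sigma>) \<and>
      (\<forall>V :: real^'m^'k.
         \<Gamma> = induced_subdivision simplex_product (lifting_height V) \<longrightarrow>
         regular_subdivision (hypersimplex k) \<Sigma> \<and>
         \<Sigma> = induced_subdivision (hypersimplex k) (tau_height V)) \<and>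
      (\<not> regular_subdivision simplex_product \<Gamma> \<longrightarrow>
         \<not> regular_subdivision (hypersimplex k) \<Sigma>)"
proof -
  let ?Q = "truncated_cone simplex_product :: (real^('k + 'm)) set"
  note sub = assms(5)
  note cell = subdivision_simplex_product_cell[OF sub]
  have hyp: "hypersimplex k = iota ` ?Q" using hypersimplex_eq assms(3) by metis
  define \<Sigma> where "\<Sigma> = (`) iota ` cone_subdivision \<Gamma>"
  have sub\<Sigma>: "subdivision (hypersimplex k) \<Sigma>"
    unfolding hyp \<Sigma>_def
    using subdivision_affine_image[OF linear_flip_left inj_flip_left subdivision_cone_subdivision[OF sub],
        of "e_vec initial_block"]
    by (simp add: iota_eq)
  have slice: "iota ` G \<inter> perp_initial_block = iota ` (G \<inter> simplex_product)"
    if "G \<in> cone_subdivision \<Gamma>" for G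
    using iota_Int_perp cone_subdivision_subset[OF sub that] by blast
  have figure: "{C \<inter> perp_initial_block | C. C \<in> \<Sigma>} = {iota ` F | F. F \<in> \<Gamma>}"
  proof (intro equalityI subsetI)
    fix D assume "D \<in> {C \<inter> perp_initial_block | C. C \<in> \<Sigma>}"
    then obtain G where "G \<in> cone_subdivision \<Gamma>" "D = iota ` G \<inter> perp_initial_block"
      by (auto simp: \<Sigma>_def)
    then show "D \<in> {iota ` F | F. F \<in> \<Gamma>}"
      using slice cone_subdivision_slice[OF sub] by blast
  next
    fix D assume "D \<in> {iota ` F | F. F \<in> \<Gamma>}"
    then obtain F where F: "F \<in> \<Gamma>" "D = iota ` F" by blast
    have "D = iota ` truncated_cone F \<inter> perp_initial_block"
      using slice[OF truncated_cone_in_cone_subdivision[OF sub F(1)]] F(2)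
        truncated_cone_Int_simplex_product[OF cell(1)[OF F(1)]] by simp
    then show "D \<in> {C \<inter> perp_initial_block | C. C \<in> \<Sigma>}"
      using truncated_cone_in_cone_subdivision[OF sub F(1)] by (auto simp: \<Sigma>_def)
  qed
  have apex: "e_vec initial_block \<in> C" if C: "C \<in> maximal_cells \<Sigma>" for C
  proof -
    obtain G F where G: "C = iota ` G" "F \<in> \<Gamma>" "G face_of truncated_cone F"
      using C by (auto simp: maximal_cells_def \<Sigma>_def cone_subdivision_def)
    have "iota ` truncated_cone F \<in> \<Sigma>"
      using truncated_cone_in_cone_subdivision[OF sub G(2)] by (simp add: \<Sigma>_def)
    moreover have "C \<subseteq> iota ` truncated_cone F" using G face_of_imp_subset by blast
    \<comment> \<open>A maximal cell is a whole truncated cone, not a proper face of one.\<close>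
    ultimately have "iota ` truncated_cone F = C" using C unfolding maximal_cells_def by blast
    moreover have "e_vec initial_block = iota 0" by (simp add: iota_eq linear_0[OF linear_flip_left])
    ultimately show ?thesis using zero_in_truncated_cone by blast
  qed
  have iso: "poset_isomorphic (tight_span simplex_product \<Gamma>) (tight_span (hypersimplex k) \<Sigma>)"
  proof -
    let ?f = "\<lambda>F. iota ` truncated_cone F"
    have cells: "interior_cells (hypersimplex k) \<Sigma> = ?f ` interior_cells simplex_product \<Gamma>"
      unfolding hyp \<Sigma>_def
      using interior_cells_affine_image[OF linear_flip_left inj_flip_left,
          of "e_vec initial_block" ?Q "cone_subdivision \<Gamma>", folded iota_eq]
      by (simp add: interior_cells_cone_subdivision[OF sub] image_image)
    have sub_iff: "?f F \<subseteq> ?f F' \<longleftrightarrow> F \<subseteq> F'" if "F \<in> \<Gamma>" "F' \<in> \<Gamma>" for F F'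
    proof -
      \<comment> \<open>Slicing undoes coning, so inclusions are reflected as well as
        preserved.\<close>
      have "truncated_cone F \<subseteq> truncated_cone F' \<longleftrightarrow> F \<subseteq> F'"
      proof
        assume "truncated_cone F \<subseteq> truncated_cone F'"
        then show "F \<subseteq> F'"
          using truncated_cone_Int_simplex_product[OF cell(1)[OF that(1)]]
            truncated_cone_Int_simplex_product[OF cell(1)[OF that(2)]] by blast
      qed (rule truncated_cone_mono)
      then show ?thesis by (simp add: inj_image_subset_iff[OF inj_iota])
    qed
    have \<Gamma>: "interior_cells simplex_product \<Gamma> \<subseteq> \<Gamma>" by (auto simp: interior_cells_def)
    have "inj_on ?f (interior_cells simplex_product \<Gamma>)"
      using sub_iff \<Gamma> by (intro inj_onI) (metis order_antisym order_refl subsetD)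
    then have "bij_betw ?f (interior_cells simplex_product \<Gamma>) (interior_cells (hypersimplex k) \<Sigma>)"
      using cells by (simp add: bij_betw_def)
    moreover have "(F, F') \<in> tight_span simplex_product \<Gamma>
        \<longleftrightarrow> (?f F, ?f F') \<in> tight_span (hypersimplex k) \<Sigma>"
      if F: "F \<in> interior_cells simplex_product \<Gamma>" "F' \<in> interior_cells simplex_product \<Gamma>" for F F'
    proof -
      have "?f F' \<subseteq> ?f F \<longleftrightarrow> F' \<subseteq> F" using F \<Gamma> by (intro sub_iff) auto
      then show ?thesis using F cells by (simp add: tight_span_def)
    qed
    ultimately show ?thesis
      unfolding poset_isomorphic_def Field_tight_span by blast
  qed
  have ind: "\<Sigma> = induced_subdivision (hypersimplex k) (tau_height V)"
    if "\<Gamma> = induced_subdivision simplex_product (lifting_height V)" for V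
  proof (rule subdivision_subset_induced_imp_eq)
    show "polytope (hypersimplex k :: (real^('k + 'm)) set)"
      by (simp add: hypersimplex_def polytope_convex_hull)
    show "hypersimplex k \<noteq> ({} :: (real^('k + 'm)) set)"
      unfolding hyp using zero_in_truncated_cone by blast
    show "\<Sigma> \<subseteq> induced_subdivision (hypersimplex k) (tau_height V)"
      unfolding hyp \<Sigma>_def
      using cone_subdivision_induced[OF sub that] induced_subdivision_iota[of ?Q "tau_height V"]
      by (meson image_mono order_trans)
  qed (rule sub\<Sigma>)
  have reg: "regular_subdivision simplex_product \<Gamma>" if reg: "regular_subdivision (hypersimplex k) \<Sigma>"
  proof -
    obtain h where h: "\<Sigma> = induced_subdivision (iota ` ?Q) h"
      using reg hyp by (auto simp: regular_subdivision_def)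
    \<comment> \<open>As \<open>iota\<close> is an involution, the one-sided transport lemma also
      carries \<open>\<Sigma>\<close> back to the cone subdivision.\<close>
    have "(`) iota ` \<Sigma> \<subseteq> induced_subdivision ?Q (\<lambda>x. h (iota x))"
      using induced_subdivision_iota[of "iota ` ?Q" "\<lambda>x. h (iota x)"] by (simp add: h)
    moreover have "(`) iota ` \<Sigma> = cone_subdivision \<Gamma>" by (simp add: \<Sigma>_def image_image)
    ultimately show ?thesis using cone_subdivision_regular_imp[OF sub] by simp
  qed
  show ?thesis
  proof (intro exI[of _ \<Sigma>] conjI ballI allI impI)
    show "regular_subdivision (hypersimplex k) \<Sigma>"
      if "\<Gamma> = induced_subdivision simplex_product (lifting_height V)" for V
      using sub\<Sigma> ind[OF that] unfolding regular_subdivision_def by blast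
    show "\<not> regular_subdivision (hypersimplex k) \<Sigma>" if "\<not> regular_subdivision simplex_product \<Gamma>"
      using reg that by blast
  qed (fact sub\<Sigma> figure apex iso ind)+
qed

end
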